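(* Suppose $M$ is a two-qutrit state (a $9\times 9$ complex positive semidefinite matrix on $\mathbb{C}^3\otimes\mathbb{C}^3$) whose partial transpose $M^\Gamma$ has inertia $(4,1,4)$. (i) If $Q$ is a $9\times 9$ complex matrix of rank at least six, then the matrix $QM^\Gamma Q^\dagger$ is not positive semidefinite. (ii) If $P$ is a $2\times 3$ complex matrix of rank two, then the projected state $(P\otimes I_3)M(P^\dagger\otimes I_3)$ on $\mathbb{C}^2\otimes\mathbb{C}^3$ is NPT, i.e. its partial transpose has at least one negative eigenvalue. (iii) The state $M$ does not exist. That is, no $9\times 9$ positive semidefinite matrix on $\mathbb{C}^3\otimes\mathbb{C}^3$ has partial transpose of inertia $(4,1,4)$; equivalently $(4,1,4)\notin\mathcal{N}_{3,3}$.
   Context: For a Hermitian matrix $H$, the inertia is $\operatorname{In}(H)=(a,b,c)$, where $a,b,c$ are the numbers (with multiplicity) of negative, zero and positive eigenvalues of $H$, in this order. A matrix $M\in\mathbb{C}^{mn\times mn}$ on $\mathbb{C}^m\otimes\mathbb{C}^n$ is written as an $m\times m$ block matrix $M=[M_{ij}]$ with blocks $M_{ij}\in\mathbb{C}^{n\times n}$; its partial transpose (on the first system) is $M^\Gamma=[M_{ji}]$, i.e. the block matrix whose $(i,j)$ block is $M_{ji}$. States are positive semidefinite matrices (not necessarily normalized). A state is NPT if its partial transpose has at least one negative eigenvalue. $\mathcal{N}_{m,n}$ is the set of all inertias $\operatorname{In}(\rho^\Gamma)$ where $\rho$ ranges over NPT states on $\mathbb{C}^m\otimes\mathbb{C}^n$.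 $A^\dagger$ denotes the conjugate transpose of $A$. *)

theory Defs
  imports
    "Jordan_Normal_Form.Char_Poly"
    "Jordan_Normal_Form.Schur_Decomposition"
    "Jordan_Normal_Form.DL_Rank"
begin

text \<open>
  Matrices on the tensor product of dimensions m and n have row and column index i * n + k, where
  i < m belongs to the first factor (block index) and k < n to the second (index inside a block).
  The order on complex numbers is the one of Complex_Order: x < 0 and 0 \<le> x entail that x is real.
\<close>

definition hermitian_mat :: "complex mat \<Rightarrow> bool" where
  "hermitian_mat A \<longleftrightarrow> square_mat A \<and> mat_adjoint A = A"

definition psd_mat :: "complex mat \<Rightarrow> bool" where
  "psd_mat A \<longleftrightarrow> hermitian_mat A \<and>
     (\<forall>v \<in> carrier_vec (dim_row A). 0 \<le> (A *\<^sub>v v) \<bullet>c v)"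

text \<open>
  Only meant for Hermitian matrices, all of whose eigenvalues are real. The multiset of roots of
  the characteristic polynomial is the multiset of eigenvalues with multiplicity. The order of the
  components is negative, zero, positive.
\<close>

definition inertia :: "complex mat \<Rightarrow> nat \<times> nat \<times> nat" where
  "inertia A =
     (size {# x \<in># proots (char_poly A). x < 0 #},
      size {# x \<in># proots (char_poly A). x = 0 #},
      size {# x \<in># proots (char_poly A). x > 0 #})"

definition partial_transpose :: "nat \<Rightarrow> nat \<Rightarrow> 'a mat \<Rightarrow> 'a mat" where
  "partial_transpose m n A = mat (m * n) (m * n)
     (\<lambda>(r, c). A $$ ((c div n) * n + r mod n, (r div n) * n + c mod n))"

definition kron :: "'a :: times mat \<Rightarrow> 'a mat \<Rightarrow> 'a mat" where
  "kron A B = mat (dim_row A * dim_row B) (dim_col A * dim_col B)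
     (\<lambda>(r, c). A $$ (r div dim_row B, c div dim_col B) * B $$ (r mod dim_row B, c mod dim_col B))"

lemma div_mod_block:
  fixes i k n :: nat
  assumes "k < n"
  shows "(i * n + k) div n = i" "(i * n + k) mod n = k"
  using assms by auto

lemma block_index_less:
  fixes i k m n :: nat
  assumes "i < m" "k < n"
  shows "i * n + k < m * n"
proof -
  have "i * n + k < Suc i * n" using assms by simp
  also have "\<dots> \<le> m * n" using assms by (intro mult_le_mono1) simp
  finally show ?thesis .
qed

lemma index_partial_transpose:
  assumes "i < m" "j < m" "k < n" "l < n"
  shows "partial_transpose m n A $$ (i * n + k, j * n + l) = A $$ (j * n + k, i * n + l)"
  using assms by (simp add: partial_transpose_def block_index_less div_mod_block)

lemma index_kron:
  assumes "i < dim_row A" "j < dim_col A" "k < dim_row B" "l < dim_col B"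
  shows "kron A B $$ (i * dim_row B + k, j * dim_col B + l) = A $$ (i, j) * B $$ (k, l)"
  using assms by (simp add: kron_def block_index_less div_mod_block)

text \<open>States are not normalized.\<close>

definition states :: "nat \<Rightarrow> nat \<Rightarrow> complex mat set" where
  "states m n = {\<rho> \<in> carrier_mat (m * n) (m * n). psd_mat \<rho>}"

definition npt_states :: "nat \<Rightarrow> nat \<Rightarrow> complex mat set" where
  "npt_states m n = {\<rho> \<in> states m n. \<exists>x < 0. eigenvalue (partial_transpose m n \<rho>) x}"

definition npt_inertias :: "nat \<Rightarrow> nat \<Rightarrow> (nat \<times> nat \<times> nat) set" where
  "npt_inertias m n = (\<lambda>\<rho>. inertia (partial_transpose m n \<rho>)) ` npt_states m n"

end

theory Submission
  imports Defs
begin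

text \<open>
  Write H for the partial transpose of M, and suppose that H has four positive and four negative
  eigenvalues. Orthogonality to the four positive eigenvectors amounts to four bilinear equations
  for a product vector, and four such equations on C^3 x C^3 always have a nontrivial solution
  (a, b). As H is nonnegative on product vectors, H kills a (x) b, and hence M kills conj a (x) b.
  Shift M and H by a small multiple of the identity, so that M becomes positive definite and H still
  has four negative eigenvalues. Extend a = f0 and b = g0 to bases of the two factors that are
  orthonormal for the forms H(. (x) b) and H(a (x) .). Then the five vectors fi (x) gj with i = 0 or
  j = 0 are orthonormal for H, and their analogues are orthonormal for M. Completing squares, the
  remaining four diagonal entries of H are at most the squared norms of the off-diagonal columns by
  the signature of H, whereas those of M exceed the corresponding quantities. However, both diagonals
  are the same, and the partial transpose preserves the total of the squared norms.
\<close>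

subsection \<open>Linear systems and unobservable eigenvectors\<close>

text \<open>Gaussian elimination, one equation per induction step: an unknown \<open>p\<close> with
  nonzero coefficient in equation \<open>b\<close> is solved for and substituted into the other
  equations. Arbitrary finite index sets are allowed because later systems are indexed by pairs and
  by sets of eigenvalues.\<close>

lemma homogeneous_system_nontrivial:
  fixes M :: "'b \<Rightarrow> 'a \<Rightarrow> 'f :: field"
  assumes "finite B" "finite A" "card B < card A"
  shows "\<exists>x. (\<exists>a\<in>A. x a \<noteq> 0) \<and> (\<forall>b\<in>B. (\<Sum>a\<in>A. M b a * x a) = 0)"
  using assms
proof (induction B arbitrary: A M rule: finite_induct)
  case empty
  then have "A \<noteq> {}" by auto
  then show ?case by (intro exI[of _ "\<lambda>_. 1"]) auto
next
  case (insert b B)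
  show ?case
  proof (cases "\<forall>a\<in>A. M b a = 0")
    case True
    with insert.IH[of A M] insert.prems insert.hyps show ?thesis by auto
  next
    case False
    then obtain p where p: "p \<in> A" "M b p \<noteq> 0" by auto
    define A' where "A' = A - {p}"
    have A': "finite A'" "p \<notin> A'" "A = insert p A'" using p insert.prems by (auto simp: A'_def)
    then have "card B < card A'" using insert.prems insert.hyps by simp
    from insert.IH[OF A'(1) this, of "\<lambda>c a. M c a - M c p * M b a / M b p"] obtain x where
      x: "\<exists>a\<in>A'. x a \<noteq> 0"
        "\<And>c. c \<in> B \<Longrightarrow> (\<Sum>a\<in>A'. (M c a - M c p * M b a / M b p) * x a) = 0" by auto
    define y where "y = x(p := - (\<Sum>a\<in>A'. M b a * x a) / M b p)"
    have yx: "(\<Sum>a\<in>A'. M c a * y a) = (\<Sum>a\<in>A'. M c a * x a)" for c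
      by (rule sum.cong) (use A' in \<open>auto simp: y_def\<close>)
    have split: "(\<Sum>a\<in>A. M c a * y a) =
        (\<Sum>a\<in>A'. M c a * x a) - M c p / M b p * (\<Sum>a\<in>A'. M b a * x a)" for c
      using A' by (simp add: yx) (simp add: y_def)
    have "(\<Sum>a\<in>A. M b a * y a) = 0" using p by (simp add: split)
    moreover have "(\<Sum>a\<in>A. M c a * y a) = 0" if "c \<in> B" for c
    proof -
      have "(\<Sum>a\<in>A. M c a * y a) = (\<Sum>a\<in>A'. (M c a - M c p * M b a / M b p) * x a)"
        unfolding split by (simp add: left_diff_distrib sum_subtractf sum_distrib_left mult.assoc)
      then show ?thesis using x(2)[OF that] by simp
    qed
    moreover have "\<exists>a\<in>A. y a \<noteq> 0" using x(1) A' by (auto simp: y_def)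
    ultimately show ?thesis by (intro exI[of _ y]) auto
  qed
qed

text \<open>The right-hand side joins the system as one more column, at the index
  \<open>None\<close>. The enlarged homogeneous system has a nontrivial solution; injectivity forces
  its \<open>None\<close> entry to be nonzero, and dividing by it gives the solution.\<close>

lemma square_system_solvable:
  fixes R :: "'b \<Rightarrow> 'a \<Rightarrow> 'f :: field"
  assumes fin: "finite A" "finite B" "card B = card A"
    and inj: "\<And>x. \<forall>b\<in>B. (\<Sum>a\<in>A. R b a * x a) = 0 \<Longrightarrow> \<forall>a\<in>A. x a = 0"
  shows "\<exists>x. \<forall>b\<in>B. (\<Sum>a\<in>A. R b a * x a) = r b"
proof -
  define A' where "A' = insert None (Some ` A)"
  have "card B < card A'" using fin by (simp add: A'_def card_image card_insert_if image_iff)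
  moreover have "finite A'" using fin by (simp add: A'_def)
  ultimately obtain y where y: "\<exists>a\<in>A'. y a \<noteq> 0"
      "\<And>b. b \<in> B \<Longrightarrow> (\<Sum>a\<in>A'. (case a of None \<Rightarrow> - r b | Some a \<Rightarrow> R b a) * y a) = 0"
    using homogeneous_system_nontrivial[of B A'
      "\<lambda>b a. case a of None \<Rightarrow> - r b | Some a \<Rightarrow> R b a"] fin by auto
  have eq: "(\<Sum>a\<in>A. R b a * y (Some a)) = r b * y None" if "b \<in> B" for b
    using y(2)[OF that] fin by (simp add: A'_def sum.insert_if image_iff sum.reindex)
  have nz: "y None \<noteq> 0"
  proof
    assume "y None = 0"
    with inj[of "\<lambda>a. y (Some a)"] eq have "\<forall>a\<in>A. y (Some a) = 0" by auto
    with \<open>y None = 0\<close> y(1) show False by (auto simp: A'_def)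
  qed
  have "(\<Sum>a\<in>A. R b a * (y (Some a) / y None)) = r b" if "b \<in> B" for b
    using eq[OF that] nz by (simp add: sum_divide_distrib[symmetric])
  then show ?thesis by (intro exI[of _ "\<lambda>a. y (Some a) / y None"]) auto
qed

text \<open>In effect \<open>v i\<close> is K^i v_0, and the last hypothesis says that p(K)
  annihilates v_0. Splitting off a root \<open>\<mu>\<close> of \<open>p\<close> gives (K - \<mu>)
  q(K) v_0 = 0, so q(K) v_0 is an eigenvector unless it vanishes; in that case \<open>q\<close>
  takes the place of \<open>p\<close>.\<close>

lemma krylov_eigenvector_aux:
  fixes v :: "nat \<Rightarrow> 'a \<Rightarrow> complex"
  assumes step: "\<And>i a. a \<in> A \<Longrightarrow> v (Suc i) a = (\<Sum>s\<in>A. K a s * v i s)"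
    and "a0 \<in> A" "v 0 a0 \<noteq> 0"
    and "p \<noteq> 0"
    and "\<And>a. a \<in> A \<Longrightarrow> (\<Sum>i\<le>degree p. coeff p i * v i a) = 0"
  shows "\<exists>q \<mu>. degree q < degree p \<and> (\<exists>a\<in>A. (\<Sum>i\<le>degree q. coeff q i * v i a) \<noteq> 0) \<and>
     (\<forall>a\<in>A. (\<Sum>s\<in>A. K a s * (\<Sum>i\<le>degree q. coeff q i * v i s)) =
        \<mu> * (\<Sum>i\<le>degree q. coeff q i * v i a))"
  using assms(4,5)
proof (induction "degree p" arbitrary: p rule: less_induct)
  case less
  have "degree p \<noteq> 0"
  proof
    assume d: "degree p = 0"
    then have "coeff p 0 \<noteq> 0" using leading_coeff_neq_0[OF less.prems(1)] by simp
    then show False using less.prems(2)[OF assms(2)] assms(3) d by simp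
  qed
  then have "\<not> constant (poly p)" by (simp add: constant_degree)
  then obtain \<mu> where "poly p \<mu> = 0" using fundamental_theorem_of_algebra by blast
  then obtain q where q: "p = [:-\<mu>, 1:] * q" by (auto simp: poly_eq_0_iff_dvd dvd_def)
  then have q0: "q \<noteq> 0" using less.prems(1) by (metis mult_zero_right)
  have dp: "degree p = Suc (degree q)" using q0 degree_mult_eq[of "[:-\<mu>, 1:]" q] unfolding q
    by (simp del: mult_pCons_left)
  let ?u = "\<lambda>a. \<Sum>i\<le>degree q. coeff q i * v i a"
  have ev: "(\<Sum>s\<in>A. K a s * ?u s) = \<mu> * ?u a" if a: "a \<in> A" for a
  proof -
    have "(\<Sum>s\<in>A. K a s * ?u s) = (\<Sum>i\<le>degree q. coeff q i * v (Suc i) a)"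
      unfolding step[OF a] sum_distrib_left
      by (subst sum.swap) (simp add: mult_ac)
    also have "\<dots> = (\<Sum>i\<le>Suc (degree q). (if i = 0 then 0 else coeff q (i - 1)) * v i a)"
      by (subst sum.atMost_Suc_shift) simp
    finally have 1: "(\<Sum>s\<in>A. K a s * ?u s) = \<dots>" .
    have 2: "?u a = (\<Sum>i\<le>Suc (degree q). coeff q i * v i a)"
      by (simp add: coeff_eq_0)
    have "coeff p i = (if i = 0 then 0 else coeff q (i - 1)) - \<mu> * coeff q i" for i
      unfolding q by (cases i) auto
    then have "0 = (\<Sum>i\<le>Suc (degree q). ((if i = 0 then 0 else coeff q (i - 1)) - \<mu> * coeff q i) * v i a)"
      using less.prems(2)[OF a] unfolding dp by (simp only:)
    then show ?thesis unfolding 1 2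
      by (simp add: algebra_simps sum_subtractf sum_distrib_left del: sum.atMost_Suc)
  qed
  show ?case
  proof (cases "\<exists>a\<in>A. ?u a \<noteq> 0")
    case True
    then show ?thesis using ev dp by (intro exI[of _ q] exI[of _ \<mu>]) auto
  next
    case False
    then have "\<And>a. a \<in> A \<Longrightarrow> ?u a = 0" by blast
    moreover have "degree q < degree p" using dp by simp
    ultimately show ?thesis using less.hyps[OF _ q0] by (meson less_trans)
  qed
qed

text \<open>The Hautus test of control theory: an unobservable vector produces an unobservable
  eigenvector.\<close>

lemma unobservable_eigenvector:
  fixes v :: "nat \<Rightarrow> 'a \<Rightarrow> complex"
  assumes fin: "finite A"
    and step: "\<And>i a. a \<in> A \<Longrightarrow> v (Suc i) a = (\<Sum>s\<in>A. K a s * v i s)"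
    and v0: "\<exists>a\<in>A. v 0 a \<noteq> 0"
    and unobs: "\<And>c i. c \<in> C \<Longrightarrow> i < card A \<Longrightarrow> (\<Sum>a\<in>A. c a * v i a) = 0"
  shows "\<exists>u \<mu>. (\<exists>a\<in>A. u a \<noteq> 0) \<and> (\<forall>a\<in>A. (\<Sum>s\<in>A. K a s * u s) = \<mu> * u a) \<and>
     (\<forall>c\<in>C. (\<Sum>a\<in>A. c a * u a) = 0)"
proof -
  \<comment> \<open>The \<open>card A + 1\<close> vectors \<open>v 0\<close>, ...,
    \<open>v (card A)\<close> live in dimension \<open>card A\<close>, so they satisfy a linear
    relation; \<open>p\<close> collects its coefficients.\<close>
  obtain x where x: "\<exists>i\<le>card A. x i \<noteq> 0" "\<And>a. a \<in> A \<Longrightarrow> (\<Sum>i\<le>card A. v i a * x i) = 0"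
    using homogeneous_system_nontrivial[of A "{..card A}" "\<lambda>a i. v i a"] fin by auto
  define p where "p = (\<Sum>i\<le>card A. monom (x i) i)"
  have cp: "coeff p i = (if i \<le> card A then x i else 0)" for i
    by (simp add: p_def coeff_sum)
  then have p0: "p \<noteq> 0" using x(1) by (metis coeff_0)
  have dp: "degree p \<le> card A" by (rule degree_le) (simp add: cp)
  have rel: "(\<Sum>i\<le>degree p. coeff p i * v i a) = 0" if "a \<in> A" for a
  proof -
    have "(\<Sum>i\<le>degree p. coeff p i * v i a) = (\<Sum>i\<le>card A. coeff p i * v i a)"
      by (rule sum.mono_neutral_left) (use dp in \<open>auto simp: coeff_eq_0\<close>)
    also have "\<dots> = 0" using x(2)[OF that] by (simp add: cp mult.commute)
    finally show ?thesis .
  qed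
  from v0 obtain a0 where a0: "a0 \<in> A" "v 0 a0 \<noteq> 0" by auto
  obtain q \<mu> where q: "degree q < degree p" "\<exists>a\<in>A. (\<Sum>i\<le>degree q. coeff q i * v i a) \<noteq> 0"
    "\<forall>a\<in>A. (\<Sum>s\<in>A. K a s * (\<Sum>i\<le>degree q. coeff q i * v i s)) =
        \<mu> * (\<Sum>i\<le>degree q. coeff q i * v i a)"
    using krylov_eigenvector_aux[where v = v and K = K and A = A, OF step a0 p0 rel] by blast
  \<comment> \<open>The degree of \<open>q\<close> is below \<open>card A\<close>, so the
    observations with \<open>i < card A\<close> cover every term.\<close>
  have "(\<Sum>a\<in>A. c a * (\<Sum>i\<le>degree q. coeff q i * v i a)) = 0" if c: "c \<in> C" for c
  proof -
    have "(\<Sum>a\<in>A. c a * (\<Sum>i\<le>degree q. coeff q i * v i a)) =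
      (\<Sum>i\<le>degree q. coeff q i * (\<Sum>a\<in>A. c a * v i a))"
      unfolding sum_distrib_left by (subst sum.swap) (simp add: mult_ac)
    also have "\<dots> = 0" using unobs[OF c] q(1) dp by (intro sum.neutral) auto
    finally show ?thesis .
  qed
  with q show ?thesis by (intro exI[of _ "\<lambda>a. \<Sum>i\<le>degree q. coeff q i * v i a"] exI[of _ \<mu>]) auto
qed

subsection \<open>Bilinear systems\<close>

text \<open>A predicate on functions, so that closure rules can follow the recursion that defines
  the matrix entries without any polynomial being written down.\<close>

definition polynomial_map :: "('a :: comm_ring_1 \<Rightarrow> 'a) \<Rightarrow> bool" where
  "polynomial_map f \<longleftrightarrow> (\<exists>p. \<forall>x. f x = poly p x)"

lemma polynomial_map_const: "polynomial_map (\<lambda>x. c)"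
  unfolding polynomial_map_def by (rule exI[of _ "[:c:]"]) simp

lemma polynomial_map_ident: "polynomial_map (\<lambda>x. x)"
  unfolding polynomial_map_def by (rule exI[of _ "[:0, 1:]"]) simp

lemma polynomial_map_add:
  "polynomial_map f \<Longrightarrow> polynomial_map g \<Longrightarrow> polynomial_map (\<lambda>x. f x + g x)"
  unfolding polynomial_map_def by (metis poly_add)

lemma polynomial_map_mult:
  "polynomial_map f \<Longrightarrow> polynomial_map g \<Longrightarrow> polynomial_map (\<lambda>x. f x * g x)"
  unfolding polynomial_map_def by (metis poly_mult)

lemma polynomial_map_sum:
  "(\<And>i. i \<in> I \<Longrightarrow> polynomial_map (f i)) \<Longrightarrow> polynomial_map (\<lambda>x. \<Sum>i\<in>I. f i x)"
  by (induction I rule: infinite_finite_induct)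
    (auto intro: polynomial_map_const polynomial_map_add)

lemma polynomial_map_prod:
  "(\<And>i. i \<in> I \<Longrightarrow> polynomial_map (f i)) \<Longrightarrow> polynomial_map (\<lambda>x. \<Prod>i\<in>I. f i x)"
  by (induction I rule: infinite_finite_induct)
    (auto intro: polynomial_map_const polynomial_map_mult)

lemmas polynomial_map_intros = polynomial_map_const polynomial_map_ident polynomial_map_add
  polynomial_map_mult polynomial_map_sum polynomial_map_prod

lemma polynomial_map_det:
  assumes "\<And>i j. i < n \<Longrightarrow> j < n \<Longrightarrow> polynomial_map (\<lambda>x. A x i j)"
  shows "polynomial_map (\<lambda>x. det (mat n n (\<lambda>(i, j). A x i j)))"
proof -
  have "det (mat n n (\<lambda>(i, j). A x i j)) =
      (\<Sum>p | p permutes {0..<n}. signof p * (\<Prod>i = 0..<n. A x i (p i)))" for x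
    by (subst det_def'[OF mat_carrier]) (intro sum.cong refl arg_cong2[of _ _ _ _ "(*)"] prod.cong,
      auto simp: permutes_in_image dest: permutes_in_image)
  then show ?thesis using assms
    by (auto intro!: polynomial_map_intros simp: permutes_in_image dest: permutes_in_image)
qed

lemma det_scale_rows:
  fixes A :: "nat \<Rightarrow> nat \<Rightarrow> 'a :: comm_ring_1"
  shows "det (mat n n (\<lambda>(i, j). c i * A i j)) = (\<Prod>i<n. c i) * det (mat n n (\<lambda>(i, j). A i j))"
proof -
  have *: "(\<Prod>i = 0..<n. mat n n (\<lambda>(i, j). c i * A i j) $$ (i, p i)) =
      (\<Prod>i<n. c i) * (\<Prod>i = 0..<n. mat n n (\<lambda>(i, j). A i j) $$ (i, p i))"
    if "p permutes {0..<n}" for p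
  proof -
    have "(\<Prod>i = 0..<n. mat n n (\<lambda>(i, j). c i * A i j) $$ (i, p i)) =
      (\<Prod>i = 0..<n. c i * mat n n (\<lambda>(i, j). A i j) $$ (i, p i))"
      using permutes_in_image[OF that] by (intro prod.cong) auto
    then show ?thesis by (simp add: prod.distrib atLeast0LessThan)
  qed
  show ?thesis
    unfolding det_def'[OF mat_carrier] sum_distrib_left
    by (rule sum.cong[OF refl]) (simp add: * mult.left_commute del: index_mat)
qed

lemma det_eq_0_imp_kernel:
  fixes A :: "nat \<Rightarrow> nat \<Rightarrow> 'a :: field"
  assumes "det (mat n n (\<lambda>(i, j). A i j)) = 0"
  shows "\<exists>x. (\<exists>j<n. x j \<noteq> 0) \<and> (\<forall>i<n. (\<Sum>j<n. A i j * x j) = 0)"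
proof -
  obtain v where v: "v \<in> carrier_vec n" "v \<noteq> 0\<^sub>v n" "mat n n (\<lambda>(i, j). A i j) *\<^sub>v v = 0\<^sub>v n"
    using det_0_iff_vec_prod_zero_field[of "mat n n (\<lambda>(i, j). A i j)" n] assms by auto
  have "(\<Sum>j<n. A i j * v $ j) = 0" if "i < n" for i
  proof -
    have "(mat n n (\<lambda>(i, j). A i j) *\<^sub>v v) $ i = (\<Sum>j<n. A i j * v $ j)"
      using v(1) that by (auto simp: scalar_prod_def atLeast0LessThan)
    then show ?thesis using v(3) that by simp
  qed
  moreover have "\<exists>j<n. v $ j \<noteq> 0" using v(1,2) by (metis carrier_vecD eq_vecI index_zero_vec)
  ultimately show ?thesis by blast
qed

text \<open>Without a zero, the two dehomogenizations D(y, 1) and D(1, z) are polynomials without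
  roots, hence constant with the common value D(1, 1). Homogeneity then turns D(2, 1) = 2^d D(1,
  1/2) into 2^d = 1.\<close>

lemma homogeneous_binary_form_zero:
  fixes D :: "complex \<Rightarrow> complex \<Rightarrow> complex"
  assumes poly: "polynomial_map (\<lambda>y. D y 1)" "polynomial_map (D 1)"
    and hom: "\<And>c y z. D (c * y) (c * z) = c ^ d * D y z" and d: "d > 0"
  shows "\<exists>y z. (y, z) \<noteq> (0, 0) \<and> D y z = 0"
proof (rule ccontr)
  assume "\<not> ?thesis"
  then have nz: "D y 1 \<noteq> 0" "D 1 y \<noteq> 0" for y by (metis prod.inject zero_neq_one)+
  from poly obtain p q where p: "\<And>y. D y 1 = poly p y" and q: "\<And>z. D 1 z = poly q z"
    unfolding polynomial_map_def by blast
  have "constant (poly p)" "constant (poly q)"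
    using fundamental_theorem_of_algebra nz p q by metis+
  then have "poly p 2 = poly p 1" "poly q (1/2) = poly q 1" unfolding constant_def by blast+
  then have "D 2 1 = D 1 1" "D 1 (1/2) = D 1 1" using p[of 1] p[of 2] q[of 1] q[of "1/2"] by simp_all
  moreover have "D 2 1 = 2 ^ d * D 1 (1/2)" using hom[of 2 1 "1/2"] by simp
  ultimately have "2 ^ d = (1 :: complex)" using nz(2)[of 1] by simp
  then have "norm ((2 :: complex) ^ d) = 1" by simp
  then have "(2 :: real) ^ d = 1" by (simp add: norm_power)
  with d show False using one_less_power[of "2 :: real" d] by linarith
qed

text \<open>If R is invertible, the first n equations say that b is an eigenvector of
  K = R^-1 (y S + z T) for the eigenvalue -x. By the Hautus test, such a b also annihilated by the row
  c = y s + z t exists as soon as the observability matrix with rows c K^i is singular, and its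
  determinant is homogeneous of positive degree in (y, z).\<close>

lemma matrix_pencil_drops_rank:
  fixes R S T :: "nat \<Rightarrow> nat \<Rightarrow> complex" and s t :: "nat \<Rightarrow> complex"
  assumes n: "n > 0"
  shows "\<exists>x y z b. (x, y, z) \<noteq> (0, 0, 0) \<and> (\<exists>k<n. b k \<noteq> 0) \<and>
    (\<forall>r<n. (\<Sum>k<n. (x * R r k + y * S r k + z * T r k) * b k) = 0) \<and>
    (\<Sum>k<n. (y * s k + z * t k) * b k) = 0"
proof (cases "\<exists>b. (\<exists>k<n. b k \<noteq> 0) \<and> (\<forall>r<n. (\<Sum>k<n. R r k * b k) = 0)")
  case True
  then obtain b where "\<exists>k<n. b k \<noteq> 0" "\<forall>r<n. (\<Sum>k<n. R r k * b k) = 0" by auto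
  \<comment> \<open>If R is singular, the point (1, 0, 0) works, and the last equation becomes
    trivial.\<close>
  then show ?thesis by (intro exI[of _ 1] exI[of _ 0] exI[of _ b]) auto
next
  case False
  then have inj: "\<forall>k\<in>{..<n}. x k = 0" if "\<forall>r\<in>{..<n}. (\<Sum>k<n. R r k * x k) = 0" for x
    using that by blast
  have "\<exists>x. \<forall>r<n. (\<Sum>k<n. R r k * x k) = w r" for w
    using square_system_solvable[where r = w, OF finite_lessThan finite_lessThan refl inj]
    by (simp add: Ball_def)
  then obtain X where X: "\<And>w r. r < n \<Longrightarrow> (\<Sum>k<n. R r k * X w k) = w r" by metis
  define K where "K y z k l = y * X (\<lambda>r. S r l) k + z * X (\<lambda>r. T r l) k" for y z k l
  have RK: "(\<Sum>k<n. R r k * K y z k l) = y * S r l + z * T r l" if "r < n" for r l y z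
  proof -
    have "(\<Sum>k<n. R r k * K y z k l) =
        y * (\<Sum>k<n. R r k * X (\<lambda>r. S r l) k) + z * (\<Sum>k<n. R r k * X (\<lambda>r. T r l) k)"
      by (simp add: K_def distrib_left sum.distrib sum_distrib_left mult_ac)
    then show ?thesis by (simp add: X[OF that])
  qed
  \<comment> \<open>\<open>row y z i\<close> is c K^i, row i of the observability matrix. Its
    entries are homogeneous of degree i + 1 in (y, z), which explains the exponent in the
    homogeneity of \<open>D\<close>.\<close>
  define row where "row y z = rec_nat (\<lambda>k. y * s k + z * t k) (\<lambda>i f k. \<Sum>l<n. f l * K y z l k)" for y z
  have row0: "row y z 0 k = y * s k + z * t k"
    and rowS: "row y z (Suc i) k = (\<Sum>l<n. row y z i l * K y z l k)" for y z i k
    by (simp_all add: row_def)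
  define D where "D y z = det (mat n n (\<lambda>(i, j). row y z i j))" for y z
  have Khom: "K (c * y) (c * z) k l = c * K y z k l" for c y z k l
    by (simp add: K_def algebra_simps)
  have rowhom: "row (c * y) (c * z) i k = c ^ Suc i * row y z i k" for c y z i k
  proof (induction i arbitrary: k)
    case 0
    show ?case by (simp add: row0 algebra_simps)
  next
    case (Suc i)
    show ?case by (simp add: rowS Suc Khom sum_distrib_left mult_ac)
  qed
  have "polynomial_map (\<lambda>y. row y 1 i k)" "polynomial_map (\<lambda>z. row 1 z i k)" for i k
    by (induction i arbitrary: k) (simp_all only: row0 rowS K_def polynomial_map_intros)
  then have "polynomial_map (\<lambda>y. D y 1)" "polynomial_map (D 1)"
    unfolding D_def by (auto intro!: polynomial_map_det)
  moreover have "D (c * y) (c * z) = c ^ (\<Sum>i<n. Suc i) * D y z" for c y z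
    unfolding D_def rowhom det_scale_rows by (simp only: power_sum)
  moreover have "(\<Sum>i<n. Suc i) > 0" using n by (intro sum_pos) auto
  ultimately obtain y z where yz: "(y, z) \<noteq> (0, 0)" "D y z = 0"
    using homogeneous_binary_form_zero[of D] by metis
  obtain b where b: "\<exists>k<n. b k \<noteq> 0" "\<And>i. i < n \<Longrightarrow> (\<Sum>k<n. row y z i k * b k) = 0"
    using det_eq_0_imp_kernel[OF yz(2)[unfolded D_def]] by auto
  \<comment> \<open>\<open>v i\<close> is K^i b. Moving the powers of K from the row to the vector
    turns a kernel vector of the observability matrix into an unobservable vector.\<close>
  define v where "v = rec_nat b (\<lambda>i f k. \<Sum>l<n. K y z k l * f l)"
  have v0: "v 0 = b" and vS: "v (Suc i) k = (\<Sum>l<n. K y z k l * v i l)" for i k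
    by (simp_all add: v_def)
  have "(\<Sum>k<n. row y z i k * v j k) = (\<Sum>k<n. row y z 0 k * v (i + j) k)" for i j
  proof (induction i arbitrary: j)
    case (Suc i)
    have "(\<Sum>k<n. row y z (Suc i) k * v j k) = (\<Sum>k<n. row y z i k * v (Suc j) k)"
      unfolding rowS vS sum_distrib_left sum_distrib_right
      by (subst sum.swap) (simp add: mult_ac)
    then show ?case using Suc[of "Suc j"] by simp
  qed simp
  from this[of _ 0] b(2) have unobs: "(\<Sum>k<n. row y z 0 k * v i k) = 0" if "i < n" for i
    using that by (simp add: v0)
  have "\<exists>u \<mu>. (\<exists>a\<in>{..<n}. u a \<noteq> 0) \<and> (\<forall>a\<in>{..<n}. (\<Sum>s<n. K y z a s * u s) = \<mu> * u a) \<and>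
     (\<forall>c\<in>{row y z 0}. (\<Sum>a<n. c a * u a) = 0)"
    by (rule unobservable_eigenvector[of "{..<n}" v]) (use vS v0 b(1) unobs in auto)
  then obtain u \<mu> where u: "\<exists>k<n. u k \<noteq> 0" "\<And>k. k < n \<Longrightarrow> (\<Sum>l<n. K y z k l * u l) = \<mu> * u k"
    "(\<Sum>k<n. row y z 0 k * u k) = 0" by auto
  have "(\<Sum>k<n. (- \<mu> * R r k + y * S r k + z * T r k) * u k) = 0" if r: "r < n" for r
  proof -
    have "(\<Sum>l<n. (y * S r l + z * T r l) * u l) = (\<Sum>k<n. R r k * (\<Sum>l<n. K y z k l * u l))"
      unfolding RK[OF r, symmetric] sum_distrib_left sum_distrib_right
      by (subst sum.swap) (simp add: mult_ac)
    also have "\<dots> = (\<Sum>k<n. R r k * (\<mu> * u k))" using u(2) by simp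
    finally show ?thesis by (simp add: algebra_simps sum.distrib sum_subtractf)
  qed
  then show ?thesis using u yz(1)
    by (intro exI[of _ "- \<mu>"] exI[of _ y] exI[of _ z] exI[of _ u]) (auto simp: row0)
qed

text \<open>Some combination of the n + 1 equations, with coefficients l, does not involve the
  coordinate 0 of a; it replaces an equation p with nonzero coefficient.\<close>

lemma bilinear_system_nontrivial:
  fixes C :: "'i \<Rightarrow> nat \<Rightarrow> nat \<Rightarrow> complex"
  assumes n: "n > 0" and I: "finite I" "card I = Suc n"
  shows "\<exists>a b. (\<exists>j<3. a j \<noteq> 0) \<and> (\<exists>k<n. b k \<noteq> 0) \<and>
    (\<forall>i\<in>I. (\<Sum>j<3. \<Sum>k<n. C i j k * a j * b k) = 0)"
proof -
  obtain l where l: "\<exists>i\<in>I. l i \<noteq> 0" "\<And>k. k < n \<Longrightarrow> (\<Sum>i\<in>I. C i 0 k * l i) = 0"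
    using homogeneous_system_nontrivial[of "{..<n}" I "\<lambda>k i. C i 0 k"] I by auto
  then obtain p where p: "p \<in> I" "l p \<noteq> 0" by auto
  have "card (I - {p}) = n" using p I by simp
  then obtain e where e: "bij_betw e {..<n} (I - {p})"
    using ex_bij_betw_nat_finite[of "I - {p}"] I(1) by (metis atLeast0LessThan finite_Diff)
  from matrix_pencil_drops_rank[OF n, of "\<lambda>r. C (e r) 0" "\<lambda>r. C (e r) 1" "\<lambda>r. C (e r) 2"
      "\<lambda>k. \<Sum>i\<in>I. l i * C i 1 k" "\<lambda>k. \<Sum>i\<in>I. l i * C i 2 k"]
  obtain x y z b where sol: "(x, y, z) \<noteq> (0, 0, 0)" "\<exists>k<n. b k \<noteq> 0"
    "\<And>r. r < n \<Longrightarrow> (\<Sum>k<n. (x * C (e r) 0 k + y * C (e r) 1 k + z * C (e r) 2 k) * b k) = 0"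
    "(\<Sum>k<n. (y * (\<Sum>i\<in>I. l i * C i 1 k) + z * (\<Sum>i\<in>I. l i * C i 2 k)) * b k) = 0"
    by (elim exE conjE) (rule that, auto)
  define F where "F i = (\<Sum>k<n. (x * C i 0 k + y * C i 1 k + z * C i 2 k) * b k)" for i
  have F0: "F i = 0" if "i \<in> I - {p}" for i
  proof -
    obtain r where "r < n" "i = e r" using bij_betw_imp_surj_on[OF e] \<open>i \<in> I - {p}\<close> by blast
    then show ?thesis unfolding F_def using sol(3) by simp
  qed
  \<comment> \<open>The \<open>l\<close>-combination of all equations vanishes at the solution. So
    do the equations other than \<open>p\<close>, and \<open>l p\<close> is nonzero, so equation
    \<open>p\<close> holds as well.\<close>
  have "(\<Sum>i\<in>I. l i * F i) =
      (\<Sum>i\<in>I. \<Sum>k<n. l i * (x * C i 0 k + y * C i 1 k + z * C i 2 k) * b k)"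
    by (simp only: F_def sum_distrib_left mult.assoc)
  also have "\<dots> = (\<Sum>k<n. (\<Sum>i\<in>I. l i * (x * C i 0 k + y * C i 1 k + z * C i 2 k)) * b k)"
    by (subst sum.swap) (simp only: sum_distrib_right)
  also have "\<dots> = (\<Sum>k<n. (x * (\<Sum>i\<in>I. C i 0 k * l i) +
      (y * (\<Sum>i\<in>I. l i * C i 1 k) + z * (\<Sum>i\<in>I. l i * C i 2 k))) * b k)"
    by (simp only: distrib_left sum.distrib sum_distrib_left mult_ac add.assoc)
  also have "\<dots> = 0" using l(2) sol(4) by simp
  finally have "l p * F p = 0" using F0 by (simp add: sum.remove[OF I(1) p(1)])
  then have F: "F i = 0" if "i \<in> I" for i using F0[of i] p(2) that by (cases "i = p") simp_all
  define a where "a j = (if j = 0 then x else if j = 1 then y else z)" for j :: nat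
  have "(\<Sum>j<3. \<Sum>k<n. C i j k * a j * b k) = F i" for i
    unfolding F_def by (simp add: eval_nat_numeral a_def algebra_simps sum.distrib)
  moreover have "\<exists>j<3. a j \<noteq> 0"
  proof -
    have "a 0 \<noteq> 0 \<or> a 1 \<noteq> 0 \<or> a 2 \<noteq> 0" using sol(1) by (simp add: a_def)
    moreover have "(0::nat) < 3" "(1::nat) < 3" "(2::nat) < 3" by simp_all
    ultimately show ?thesis by blast
  qed
  ultimately show ?thesis using F sol(2) by (intro exI[of _ a] exI[of _ b]) auto
qed

subsection \<open>Hermitian matrices\<close>

lemma sum_cnj_mult_self: "(\<Sum>p\<in>A. cnj (x p) * x p) = of_real (\<Sum>p\<in>A. (cmod (x p))\<^sup>2)"
  unfolding of_real_sum
  by (rule sum.cong[OF refl]) (metis complex_norm_square mult.commute)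

lemma sum_cmod_square_pos:
  assumes "finite A" "\<exists>p\<in>A. x p \<noteq> 0"
  shows "(\<Sum>p\<in>A. (cmod (x p))\<^sup>2) > 0"
proof -
  obtain p where "p \<in> A" "x p \<noteq> 0" using assms(2) by blast
  then show ?thesis using assms(1) by (intro sum_pos2[of A p]) auto
qed

text \<open>The Krylov space of a vector orthogonal to the eigenvectors found so far stays orthogonal to
  them, so it contains a further one.\<close>

lemma hermitian_eigenvectors:
  fixes G :: "'a \<Rightarrow> 'a \<Rightarrow> complex"
  assumes fin: "finite A" and herm: "\<And>p q. p \<in> A \<Longrightarrow> q \<in> A \<Longrightarrow> G q p = cnj (G p q)"
    and m: "m \<le> card A"
  shows "\<exists>u d. (\<forall>i<m. \<forall>j<m. (\<Sum>p\<in>A. cnj (u i p) * u j p) = (if i = j then 1 else 0)) \<and>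
     (\<forall>i<m. \<forall>p\<in>A. (\<Sum>q\<in>A. G p q * u i q) = of_real (d i) * u i p)"
  using m
proof (induction m)
  case 0
  show ?case by simp
next
  case (Suc m)
  then obtain u d where
    "\<forall>i<m. \<forall>j<m. (\<Sum>p\<in>A. cnj (u i p) * u j p) = (if i = j then 1 else 0)"
    "\<forall>i<m. \<forall>p\<in>A. (\<Sum>q\<in>A. G p q * u i q) = of_real (d i) * u i p"
    using Suc_leD by blast
  then have on: "(\<Sum>p\<in>A. cnj (u i p) * u j p) = (if i = j then 1 else 0)" if "i < m" "j < m" for i j
    using that by blast
  have ev: "(\<Sum>q\<in>A. G p q * u i q) = of_real (d i) * u i p" if "i < m" "p \<in> A" for i p
    using that \<open>\<forall>i<m. \<forall>p\<in>A. _ i p\<close> by blast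
  obtain b where b: "\<exists>p\<in>A. b p \<noteq> 0" "\<And>i. i < m \<Longrightarrow> (\<Sum>p\<in>A. cnj (u i p) * b p) = 0"
    using homogeneous_system_nontrivial[of "{..<m}" A "\<lambda>i p. cnj (u i p)"] fin Suc.prems by auto
  define v where "v = rec_nat b (\<lambda>i f p. \<Sum>q\<in>A. G p q * f q)"
  have v0: "v 0 = b" and vS: "v (Suc i) p = (\<Sum>q\<in>A. G p q * v i q)" for i p
    by (simp_all add: v_def)
  have orth: "(\<Sum>p\<in>A. cnj (u i p) * v k p) = 0" if i: "i < m" for i k
  proof (induction k)
    case 0
    show ?case using b(2)[OF i] by (simp add: v0)
  next
    case (Suc k)
    \<comment> \<open>Hermitian symmetry moves \<open>G\<close> to \<open>u i\<close>, an
      eigenvector with real eigenvalue, so orthogonality passes from \<open>v k\<close> to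
      \<open>v (Suc k)\<close>.\<close>
    have adj: "(\<Sum>p\<in>A. cnj (u i p) * G p q) = of_real (d i) * cnj (u i q)" if "q \<in> A" for q
    proof -
      have "(\<Sum>p\<in>A. cnj (u i p) * G p q) = cnj (\<Sum>p\<in>A. G q p * u i p)"
        unfolding cnj_sum by (rule sum.cong[OF refl]) (simp add: herm[OF that])
      then show ?thesis using ev[OF i that] by simp
    qed
    have "(\<Sum>p\<in>A. cnj (u i p) * v (Suc k) p) = (\<Sum>p\<in>A. \<Sum>q\<in>A. cnj (u i p) * G p q * v k q)"
      by (simp only: vS sum_distrib_left mult.assoc)
    also have "\<dots> = (\<Sum>q\<in>A. (\<Sum>p\<in>A. cnj (u i p) * G p q) * v k q)"
      by (subst sum.swap) (simp only: sum_distrib_right)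
    also have "\<dots> = of_real (d i) * (\<Sum>q\<in>A. cnj (u i q) * v k q)"
      by (simp add: adj sum_distrib_left mult.assoc)
    finally show ?case by (simp add: Suc)
  qed
  have "\<exists>w \<mu>. (\<exists>p\<in>A. w p \<noteq> 0) \<and> (\<forall>p\<in>A. (\<Sum>q\<in>A. G p q * w q) = \<mu> * w p) \<and>
      (\<forall>c\<in>(\<lambda>i p. cnj (u i p)) ` {..<m}. (\<Sum>p\<in>A. c p * w p) = 0)"
    by (rule unobservable_eigenvector[where v = v and K = G, OF fin vS]) (use b(1) orth in \<open>auto simp: v0\<close>)
  then obtain w \<mu> where w: "\<exists>p\<in>A. w p \<noteq> 0" and evw: "\<And>p. p \<in> A \<Longrightarrow> (\<Sum>q\<in>A. G p q * w q) = \<mu> * w p"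
    and orthw: "\<And>i. i < m \<Longrightarrow> (\<Sum>p\<in>A. cnj (u i p) * w p) = 0" by auto
  define N where "N = (\<Sum>p\<in>A. (cmod (w p))\<^sup>2)"
  have N: "N > 0" unfolding N_def by (rule sum_cmod_square_pos[OF fin w])
  have Nw: "(\<Sum>p\<in>A. cnj (w p) * w p) = of_real N" by (simp add: N_def sum_cnj_mult_self)
  have quad: "(\<Sum>p\<in>A. cnj (w p) * (\<Sum>q\<in>A. G p q * w q)) = \<mu> * of_real N"
    by (simp add: evw mult.left_commute flip: Nw sum_distrib_left)
  \<comment> \<open>A Hermitian form takes real values on the diagonal, so \<open>\<mu>\<close>
    times the positive number \<open>N\<close> is real.\<close>
  have "cnj (\<Sum>p\<in>A. cnj (w p) * (\<Sum>q\<in>A. G p q * w q)) = (\<Sum>p\<in>A. \<Sum>q\<in>A. cnj (w q) * (G q p * w p))"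
    unfolding cnj_sum complex_cnj_mult complex_cnj_cnj sum_distrib_left
    by (intro sum.cong refl) (simp add: mult_ac flip: herm)
  also have "\<dots> = (\<Sum>p\<in>A. cnj (w p) * (\<Sum>q\<in>A. G p q * w q))"
    by (subst sum.swap) (simp only: sum_distrib_left)
  finally have "cnj \<mu> = \<mu>" using N by (simp add: quad)
  then obtain e where e: "\<mu> = of_real e" by (metis Reals_cases Reals_cnj_iff)
  define w' where "w' p = w p / of_real (sqrt N)" for p
  have sN: "complex_of_real (sqrt N) * of_real (sqrt N) = of_real N"
    using N by (simp flip: of_real_mult)
  have "(\<Sum>p\<in>A. cnj (w' p) * w' p) = (\<Sum>p\<in>A. cnj (w p) * w p) / of_real N"
    by (simp add: w'_def sN flip: sum_divide_distrib)
  then have unit: "(\<Sum>p\<in>A. cnj (w' p) * w' p) = 1" using N by (simp add: Nw)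
  have orth1: "(\<Sum>p\<in>A. cnj (u i p) * w' p) = 0" if "i < m" for i
    using orthw[OF that] by (simp add: w'_def flip: sum_divide_distrib)
  have orth2: "(\<Sum>p\<in>A. cnj (w' p) * u i p) = 0" if "i < m" for i
  proof -
    have "(\<Sum>p\<in>A. cnj (w' p) * u i p) = cnj (\<Sum>p\<in>A. cnj (u i p) * w' p)"
      by (simp add: mult.commute)
    then show ?thesis using orth1[OF that] by simp
  qed
  have evw': "(\<Sum>q\<in>A. G p q * w' q) = of_real e * w' p" if "p \<in> A" for p
    using evw[OF that] by (simp add: w'_def e flip: sum_divide_distrib)
  show ?case
    by (rule exI[of _ "u(m := w')"], rule exI[of _ "d(m := e)"])
      (auto simp: less_Suc_eq on ev evw' unit orth1 orth2)
qed

lemma hermitian_mat_entry: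
  assumes "hermitian_mat A" "A \<in> carrier_mat n n" "r < n" "s < n"
  shows "A $$ (s, r) = cnj (A $$ (r, s))"
proof -
  have "A $$ (s, r) = mat_adjoint A $$ (s, r)" using assms(1) by (simp add: hermitian_mat_def)
  also have "\<dots> = cnj (A $$ (r, s))"
    using assms(2-4) by (auto simp: mat_adjoint_def mat_of_rows_index)
  finally show ?thesis .
qed

lemma size_filter_mset_upt:
  "size {# x \<in># mset (map f [0..<n]). P x #} = card {i. i < n \<and> P (f i)}"
proof -
  have "size {# x \<in># mset (map f [0..<n]). P x #} = length (filter (P \<circ> f) [0..<n])"
    by (metis filter_map length_map mset_filter size_mset)
  also have "\<dots> = card {i. i < n \<and> P (f i)}"
    by (subst length_filter_conv_card) (rule arg_cong[of _ _ card], auto)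
  finally show ?thesis .
qed

lemma index_mult_mat_sum:
  assumes "A \<in> carrier_mat m k" "B \<in> carrier_mat k n" "r < m" "s < n"
  shows "(A * B) $$ (r, s) = (\<Sum>i<k. A $$ (r, i) * B $$ (i, s))"
  using assms by (simp add: scalar_prod_def atLeast0LessThan)

text \<open>Orthonormality of the eigenvectors reads V U = 1; the matrices are square, so U V = 1,
  which is the resolution of the identity. The resulting similarity to a diagonal matrix identifies
  the roots of the characteristic polynomial with the \<open>d i\<close>.\<close>

lemma hermitian_diagonalization_inertia:
  assumes A: "A \<in> carrier_mat n n" and herm: "hermitian_mat A"
  shows "\<exists>u (d :: nat \<Rightarrow> real).
     (\<forall>r<n. \<forall>s<n. A $$ (r, s) = (\<Sum>i<n. of_real (d i) * u i r * cnj (u i s))) \<and>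
     (\<forall>r<n. \<forall>s<n. (\<Sum>i<n. u i r * cnj (u i s)) = (if r = s then 1 else 0)) \<and>
     inertia A = (card {i. i < n \<and> d i < 0}, card {i. i < n \<and> d i = 0}, card {i. i < n \<and> d i > 0})"
proof -
  have ex: "\<exists>u d. (\<forall>i<n. \<forall>j<n. (\<Sum>p<n. cnj (u i p) * u j p) = (if i = j then 1 else 0)) \<and>
     (\<forall>i<n. \<forall>p\<in>{..<n}. (\<Sum>q<n. A $$ (p, q) * u i q) = of_real (d i) * u i p)"
    by (rule hermitian_eigenvectors) (simp_all add: hermitian_mat_entry[OF herm A, symmetric])
  then obtain u d where
    u: "\<forall>i<n. \<forall>j<n. (\<Sum>p<n. cnj (u i p) * u j p) = (if i = j then 1 else 0)"
    and d: "\<forall>i<n. \<forall>p\<in>{..<n}. (\<Sum>q<n. A $$ (p, q) * u i q) = of_real (d i) * u i p"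
    by blast
  have on: "(\<Sum>p<n. cnj (u i p) * u j p) = (if i = j then 1 else 0)" if "i < n" "j < n" for i j
    using u that by blast
  have ev: "(\<Sum>q<n. A $$ (p, q) * u i q) = of_real (d i) * u i p" if "i < n" "p < n" for i p
    using d that by blast
  define U where "U = mat n n (\<lambda>(r, i). u i r)"
  define V where "V = mat n n (\<lambda>(i, r). cnj (u i r))"
  define D where "D = mat n n (\<lambda>(i, j). if i = j then complex_of_real (d i) else 0)"
  have car: "U \<in> carrier_mat n n" "V \<in> carrier_mat n n" "D \<in> carrier_mat n n"
    by (simp_all add: U_def V_def D_def)
  have VU: "V * U = 1\<^sub>m n"
    by (rule eq_matI) (auto simp: U_def V_def scalar_prod_def atLeast0LessThan on)
  then have UV: "U * V = 1\<^sub>m n" using mat_mult_left_right_inverse[of V n U] car by simp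
  have UD: "(U * D) $$ (r, i) = of_real (d i) * u i r" if "r < n" "i < n" for r i
    using that by (simp add: U_def D_def scalar_prod_def if_distrib cong: if_cong)
  have "A * U = U * D"
  proof (rule eq_matI)
    fix r i assume "r < dim_row (U * D)" "i < dim_col (U * D)"
    then have ri: "r < n" "i < n" using car by auto
    have "(A * U) $$ (r, i) = (\<Sum>q<n. A $$ (r, q) * u i q)"
      using A ri by (simp add: U_def scalar_prod_def atLeast0LessThan)
    then show "(A * U) $$ (r, i) = (U * D) $$ (r, i)" using ev UD ri by simp
  qed (use A car in auto)
  then have "A * (U * V) = U * D * V" using A car by (simp flip: assoc_mult_mat)
  then have AU: "A = U * D * V" using A UV by simp
  have "A $$ (r, s) = (\<Sum>i<n. of_real (d i) * u i r * cnj (u i s))" if rs: "r < n" "s < n" for r s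
  proof -
    have "(U * D * V) $$ (r, s) = (\<Sum>i<n. (U * D) $$ (r, i) * V $$ (i, s))"
      by (rule index_mult_mat_sum[OF _ car(2) rs]) (use car in auto)
    then show ?thesis using rs by (simp add: AU UD V_def del: index_mult_mat(1))
  qed
  moreover have "(\<Sum>i<n. u i r * cnj (u i s)) = (if r = s then 1 else 0)" if rs: "r < n" "s < n" for r s
  proof -
    have "(U * V) $$ (r, s) = (\<Sum>i<n. u i r * cnj (u i s))"
      using rs by (simp add: U_def V_def scalar_prod_def atLeast0LessThan)
    then show ?thesis using UV rs by simp
  qed
  moreover have "inertia A = (card {i. i < n \<and> d i < 0}, card {i. i < n \<and> d i = 0}, card {i. i < n \<and> d i > 0})"
  proof -
    have "similar_mat A D" unfolding similar_mat_def similar_mat_wit_def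
      using A car UV VU AU by (intro exI[of _ U] exI[of _ V]) (auto simp: Let_def)
    then have "char_poly A = char_poly D" by (rule char_poly_similar)
    also have "\<dots> = (\<Prod>a\<leftarrow>diag_mat D. [:- a, 1:])"
      by (rule char_poly_upper_triangular[OF car(3)]) (auto simp: upper_triangular_def D_def)
    also have "diag_mat D = map (\<lambda>i. complex_of_real (d i)) [0..<n]"
      by (auto simp: diag_mat_def D_def)
    finally have "char_poly A = (\<Prod>a\<leftarrow>map (\<lambda>i. complex_of_real (d i)) [0..<n]. [:- a, 1:])" .
    moreover have "proots (\<Prod>a\<leftarrow>xs. [:- a, 1:]) = mset xs" for xs :: "complex list"
    proof (induction xs)
      case (Cons x xs)
      have "(\<Prod>a\<leftarrow>xs. [:- a, 1:]) \<noteq> 0" by (auto simp: prod_list_zero_iff)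
      then show ?case using Cons
        by (simp only: list.map prod_list.Cons) (subst proots_mult, auto simp del: mult_pCons_left)
    qed simp
    ultimately have "proots (char_poly A) = mset (map (\<lambda>i. complex_of_real (d i)) [0..<n])"
      by (simp only:)
    then show ?thesis unfolding inertia_def by (simp only: size_filter_mset_upt) (simp add: less_complex_def)
  qed
  ultimately show ?thesis by (intro exI[of _ u] exI[of _ d]) blast
qed

subsection \<open>Sesquilinear forms and the partial transpose\<close>

text \<open>Vectors are functions and the index set is explicit, so that the same form serves for
  matrices indexed by pairs, for their slices on one factor and for Gram matrices of families of
  vectors.\<close>

definition sform :: "'a set \<Rightarrow> ('a \<Rightarrow> 'a \<Rightarrow> complex) \<Rightarrow> ('a \<Rightarrow> complex) \<Rightarrow> ('a \<Rightarrow> complex) \<Rightarrow> complex" where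
  "sform A G s t = (\<Sum>p\<in>A. \<Sum>q\<in>A. cnj (s p) * G p q * t q)"

definition ip :: "'a set \<Rightarrow> ('a \<Rightarrow> complex) \<Rightarrow> ('a \<Rightarrow> complex) \<Rightarrow> complex" where
  "ip A s t = (\<Sum>p\<in>A. cnj (s p) * t p)"

definition tens :: "('a \<Rightarrow> complex) \<Rightarrow> ('b \<Rightarrow> complex) \<Rightarrow> 'a \<times> 'b \<Rightarrow> complex" where
  "tens a b = (\<lambda>(i, k). a i * b k)"

definition conj_fun :: "('a \<Rightarrow> complex) \<Rightarrow> 'a \<Rightarrow> complex" where
  "conj_fun a = (\<lambda>i. cnj (a i))"

text \<open>The version of \<open>partial_transpose\<close> for matrices indexed by pairs. It is
  later applied to Gram matrices of product families too.\<close>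

definition pt :: "('a \<times> 'b \<Rightarrow> 'a \<times> 'b \<Rightarrow> complex) \<Rightarrow> 'a \<times> 'b \<Rightarrow> 'a \<times> 'b \<Rightarrow> complex" where
  "pt G p q = G (fst q, snd p) (fst p, snd q)"

definition shift :: "real \<Rightarrow> ('a \<Rightarrow> 'a \<Rightarrow> complex) \<Rightarrow> 'a \<Rightarrow> 'a \<Rightarrow> complex" where
  "shift \<epsilon> G p q = G p q + (if p = q then of_real \<epsilon> else 0)"

text \<open>The identity matrix is its own partial transpose, so one shift perturbs M and its
  partial transpose alike.\<close>

lemma pt_shift: "pt (shift \<epsilon> G) = shift \<epsilon> (pt G)"
  by (auto simp: fun_eq_iff pt_def shift_def prod_eq_iff)

lemma ip_self: "ip A x x = of_real (\<Sum>p\<in>A. (cmod (x p))\<^sup>2)"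
  unfolding ip_def by (rule sum_cnj_mult_self)

lemma ip_self_pos: "finite A \<Longrightarrow> \<exists>p\<in>A. x p \<noteq> 0 \<Longrightarrow> Re (ip A x x) > 0"
  by (simp add: ip_self sum_cmod_square_pos)

lemma ip_cnj: "cnj (ip A s t) = ip A t s"
  by (simp add: ip_def mult.commute)

lemma ip_conj_fun: "ip A (conj_fun s) (conj_fun t) = ip A t s"
  by (simp add: ip_def conj_fun_def mult.commute)

lemma ip_tens: "ip (A \<times> B) (tens a b) (tens c d) = ip A a c * ip B b d"
  unfolding ip_def tens_def sum_product sum.cartesian_product by (simp add: case_prod_unfold mult_ac)

lemma ip_scale_left: "ip A (\<lambda>p. c * s p) t = cnj c * ip A s t"
  by (simp add: ip_def sum_distrib_left mult_ac)

lemma ip_scale_right: "ip A s (\<lambda>p. c * t p) = c * ip A s t"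
  by (simp add: ip_def sum_distrib_left mult_ac)

lemma ip_sum_right: "ip A s (\<lambda>p. \<Sum>i\<in>I. x i * e i p) = (\<Sum>i\<in>I. x i * ip A s (e i))"
proof -
  have "ip A s (\<lambda>p. \<Sum>i\<in>I. x i * e i p) = (\<Sum>p\<in>A. \<Sum>i\<in>I. x i * (cnj (s p) * e i p))"
    by (simp add: ip_def sum_distrib_left mult.left_commute)
  also have "\<dots> = (\<Sum>i\<in>I. x i * ip A s (e i))"
    by (subst sum.swap) (simp add: ip_def sum_distrib_left)
  finally show ?thesis .
qed

lemma sform_herm:
  assumes "\<And>p q. p \<in> A \<Longrightarrow> q \<in> A \<Longrightarrow> G q p = cnj (G p q)"
  shows "sform A G t s = cnj (sform A G s t)"
proof -
  have "sform A G t s = (\<Sum>p\<in>A. \<Sum>q\<in>A. cnj (cnj (s q) * G q p * t p))"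
    unfolding sform_def by (intro sum.cong refl) (simp add: mult_ac flip: assms)
  also have "\<dots> = cnj (sform A G s t)"
    unfolding sform_def cnj_sum by (rule sum.swap)
  finally show ?thesis .
qed

lemma sform_sum_right:
  "sform A G s (\<lambda>p. \<Sum>i\<in>I. x i * e i p) = (\<Sum>i\<in>I. x i * sform A G s (e i))"
proof -
  have "sform A G s (\<lambda>p. \<Sum>i\<in>I. x i * e i p) =
      (\<Sum>p\<in>A. \<Sum>i\<in>I. \<Sum>q\<in>A. x i * (cnj (s p) * G p q * e i q))"
    unfolding sform_def sum_distrib_left
    by (subst sum.swap[of _ I]) (simp add: mult_ac)
  also have "\<dots> = (\<Sum>i\<in>I. x i * sform A G s (e i))"
    by (subst sum.swap) (simp add: sform_def sum_distrib_left)
  finally show ?thesis .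
qed

lemma sform_sum_left:
  "sform A G (\<lambda>p. \<Sum>i\<in>I. x i * e i p) t = (\<Sum>i\<in>I. cnj (x i) * sform A G (e i) t)"
proof -
  have "sform A G (\<lambda>p. \<Sum>i\<in>I. x i * e i p) t =
      (\<Sum>p\<in>A. \<Sum>i\<in>I. \<Sum>q\<in>A. cnj (x i) * (cnj (e i p) * G p q * t q))"
    unfolding sform_def cnj_sum sum_distrib_right
    by (subst sum.swap[of _ I]) (simp add: mult_ac)
  also have "\<dots> = (\<Sum>i\<in>I. cnj (x i) * sform A G (e i) t)"
    by (subst sum.swap) (simp add: sform_def sum_distrib_left)
  finally show ?thesis .
qed

lemma sform_gram:
  "sform A G (\<lambda>p. \<Sum>i\<in>I. x i * e i p) (\<lambda>p. \<Sum>i\<in>I. x i * e i p) =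
   sform I (\<lambda>i j. sform A G (e i) (e j)) x x"
  unfolding sform_sum_left unfolding sform_sum_right
  by (simp add: sform_def[of I] sum_distrib_left mult_ac)

lemma sform_shift:
  assumes "finite A"
  shows "sform A (shift \<epsilon> G) s t = sform A G s t + of_real \<epsilon> * ip A s t"
proof -
  have "sform A (shift \<epsilon> G) s t =
      (\<Sum>p\<in>A. (\<Sum>q\<in>A. cnj (s p) * G p q * t q) + (\<Sum>q\<in>A. if p = q then cnj (s p) * of_real \<epsilon> * t q else 0))"
    unfolding sform_def shift_def sum.distrib[symmetric]
    by (intro sum.cong refl) (simp add: algebra_simps)
  then show ?thesis
    using assms by (simp add: sform_def ip_def sum.distrib sum_distrib_left mult_ac)
qed

lemma sform_spectral:
  "sform A (\<lambda>p q. \<Sum>i\<in>I. c i * u i p * cnj (u i q)) s t =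
     (\<Sum>i\<in>I. c i * (cnj (ip A (u i) s) * ip A (u i) t))"
proof -
  have "sform A (\<lambda>p q. \<Sum>i\<in>I. c i * u i p * cnj (u i q)) s t =
      (\<Sum>p\<in>A. \<Sum>q\<in>A. \<Sum>i\<in>I. c i * (u i p * cnj (s p) * (cnj (u i q) * t q)))"
    by (simp add: sform_def sum_distrib_left sum_distrib_right mult_ac)
  also have "\<dots> = (\<Sum>p\<in>A. \<Sum>i\<in>I. \<Sum>q\<in>A. c i * (u i p * cnj (s p) * (cnj (u i q) * t q)))"
    by (intro sum.cong refl, rule sum.swap)
  also have "\<dots> = (\<Sum>i\<in>I. \<Sum>p\<in>A. \<Sum>q\<in>A. c i * (u i p * cnj (s p) * (cnj (u i q) * t q)))"
    by (rule sum.swap)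
  also have "\<dots> = (\<Sum>i\<in>I. c i * (cnj (ip A (u i) s) * ip A (u i) t))"
    by (simp only: ip_def cnj_sum complex_cnj_mult complex_cnj_cnj sum_product)
      (simp only: sum_distrib_left)
  finally show ?thesis .
qed

text \<open>Swapping the first components of the two indices amounts to exchanging the summation
  variables of the first factor. This is the bridge between M and its partial transpose: for a = c
  and b = d the right-hand side is a diagonal value of \<open>G\<close>, so positivity of
  \<open>G\<close> survives on product vectors.\<close>

lemma sform_pt_tens:
  "sform (A \<times> B) (pt G) (tens a b) (tens c d) =
   sform (A \<times> B) G (tens (conj_fun c) b) (tens (conj_fun a) d)"
proof -
  have flat: "sform (A \<times> B) H s t = (\<Sum>i\<in>A. \<Sum>j\<in>A. \<Sum>k\<in>B. \<Sum>l\<in>B. cnj (s (i, k)) * H (i, k) (j, l) * t (j, l))"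
    for H s t
  proof -
    have "sform (A \<times> B) H s t = (\<Sum>i\<in>A. \<Sum>k\<in>B. \<Sum>j\<in>A. \<Sum>l\<in>B. cnj (s (i, k)) * H (i, k) (j, l) * t (j, l))"
      by (simp add: sform_def sum.cartesian_product')
    then show ?thesis by (simp only: sum.swap[of _ A B])
  qed
  show ?thesis unfolding flat
    by (subst sum.swap) (simp add: pt_def tens_def conj_fun_def mult_ac)
qed

text \<open>For fixed first factors a = c this exhibits a form in the second factor alone, the shape
  to which \<open>orthonormal_extension\<close> applies.\<close>

lemma sform_tens_slice_snd:
  "sform (A \<times> B) G (tens a b) (tens c d) = sform B (\<lambda>k l. sform A (\<lambda>i j. G (i, k) (j, l)) a c) b d"
proof -
  have "sform (A \<times> B) G (tens a b) (tens c d) =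
      (\<Sum>i\<in>A. \<Sum>k\<in>B. \<Sum>j\<in>A. \<Sum>l\<in>B. cnj (b k) * (cnj (a i) * G (i, k) (j, l) * c j) * d l)"
    by (simp add: sform_def tens_def mult_ac sum.cartesian_product')
  also have "\<dots> = (\<Sum>k\<in>B. \<Sum>i\<in>A. \<Sum>l\<in>B. \<Sum>j\<in>A. cnj (b k) * (cnj (a i) * G (i, k) (j, l) * c j) * d l)"
    by (subst sum.swap) (intro sum.cong refl, rule sum.swap)
  also have "\<dots> = (\<Sum>k\<in>B. \<Sum>l\<in>B. \<Sum>i\<in>A. \<Sum>j\<in>A. cnj (b k) * (cnj (a i) * G (i, k) (j, l) * c j) * d l)"
    by (intro sum.cong refl, rule sum.swap)
  finally show ?thesis by (simp only: sform_def sum_distrib_left sum_distrib_right)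
qed

lemma sform_tens_slice_fst:
  "sform (A \<times> B) G (tens a b) (tens c d) = sform A (\<lambda>i j. sform B (\<lambda>k l. G (i, k) (j, l)) b d) a c"
proof -
  have "sform (A \<times> B) G (tens a b) (tens c d) =
      (\<Sum>i\<in>A. \<Sum>k\<in>B. \<Sum>j\<in>A. \<Sum>l\<in>B. cnj (a i) * (cnj (b k) * G (i, k) (j, l) * d l) * c j)"
    by (simp add: sform_def tens_def mult_ac sum.cartesian_product')
  also have "\<dots> = (\<Sum>i\<in>A. \<Sum>j\<in>A. \<Sum>k\<in>B. \<Sum>l\<in>B. cnj (a i) * (cnj (b k) * G (i, k) (j, l) * d l) * c j)"
    by (intro sum.cong refl, rule sum.swap)
  finally show ?thesis by (simp only: sform_def sum_distrib_left sum_distrib_right)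
qed

section \<open>Positive forms, orthonormal families and completed squares\<close>

text \<open>If z, the value of the form at (s, v), were nonzero, adding the small multiple - r z of
  \<open>s\<close> to \<open>v\<close> would change the value 0 by - 2 r |z|^2 to first order and
  make it negative.\<close>

lemma psd_form_null_vector:
  assumes herm: "\<And>p q. p \<in> A \<Longrightarrow> q \<in> A \<Longrightarrow> G q p = cnj (G p q)"
    and psd: "\<And>v. Re (sform A G v v) \<ge> 0" and null: "Re (sform A G v v) = 0"
  shows "sform A G s v = 0"
proof (rule ccontr)
  define z where "z = sform A G s v"
  \<comment> \<open>With this choice r times the value at (s, s) is at most 1, so the quadratic term
    cannot make up for the factor 2 in the linear one. The added 1 keeps the denominator
    positive.\<close>
  define r where "r = 1 / (Re (sform A G s s) + 1)"
  define x where "x i = (if i then 1 else - of_real r * z)" for i :: bool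
  define e where "e i = (if i then v else s)" for i :: bool
  assume "sform A G s v \<noteq> 0"
  then have z: "(cmod z)\<^sup>2 > 0" by (simp add: z_def)
  have r: "r > 0" "r * Re (sform A G s s) \<le> 1"
    using psd[of s] by (auto simp: r_def field_simps)
  have vs: "sform A G v s = cnj z" unfolding z_def by (rule sform_herm[OF herm])
  have "Re (sform (UNIV :: bool set) (\<lambda>i j. sform A G (e i) (e j)) x x) \<ge> 0"
    unfolding sform_gram[symmetric] by (rule psd)
  also have "sform (UNIV :: bool set) (\<lambda>i j. sform A G (e i) (e j)) x x =
      sform A G v v - 2 * of_real r * (cnj z * z) + of_real r * of_real r * (cnj z * z) * sform A G s s"
    unfolding sform_def[of UNIV] by (simp add: UNIV_bool x_def e_def vs algebra_simps flip: z_def)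
  also have "cnj z * z = of_real ((cmod z)\<^sup>2)" by (metis complex_norm_square mult.commute)
  finally have "0 \<le> r * (cmod z)\<^sup>2 * (r * Re (sform A G s s) - 2)"
    using null by (simp add: algebra_simps flip: of_real_mult)
  moreover have "r * (cmod z)\<^sup>2 * (r * Re (sform A G s s) - 2) < 0"
    by (rule mult_pos_neg) (use r z in auto)
  ultimately show False by simp
qed

text \<open>Gram-Schmidt by counting: the next vector solves m + 1 orthogonality equations in at
  least m + 2 unknowns and is then normalized. The prescribed first vector stays in place.\<close>

lemma orthonormal_extension:
  assumes fin: "finite A"
    and herm: "\<And>x y. sform A Q y x = cnj (sform A Q x y)"
    and pd: "\<And>x. \<exists>p\<in>A. x p \<noteq> 0 \<Longrightarrow> Re (sform A Q x x) > 0"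
    and g0: "sform A Q g0 g0 = 1" and m: "Suc m \<le> card A"
  shows "\<exists>g. g 0 = g0 \<and> (\<forall>i\<le>m. \<forall>j\<le>m. sform A Q (g i) (g j) = (if i = j then 1 else 0))"
  using m
proof (induction m)
  case 0
  show ?case by (rule exI[of _ "\<lambda>_. g0"]) (simp add: g0)
next
  case (Suc m)
  then obtain g where g: "g 0 = g0" "\<forall>i\<le>m. \<forall>j\<le>m. sform A Q (g i) (g j) = (if i = j then 1 else 0)"
    using Suc_leD by blast
  obtain x where x: "\<exists>p\<in>A. x p \<noteq> 0"
    "\<forall>i\<in>{..m}. (\<Sum>q\<in>A. (\<Sum>p\<in>A. cnj (g i p) * Q p q) * x q) = 0"
    using homogeneous_system_nontrivial[of "{..m}" A "\<lambda>i q. \<Sum>p\<in>A. cnj (g i p) * Q p q"]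
      fin Suc.prems by auto
  have gx: "sform A Q (g i) x = 0" if "i \<le> m" for i
  proof -
    have "sform A Q (g i) x = (\<Sum>q\<in>A. (\<Sum>p\<in>A. cnj (g i p) * Q p q) * x q)"
      unfolding sform_def sum_distrib_right by (rule sum.swap)
    then show ?thesis using x(2) that by simp
  qed
  define N where "N = Re (sform A Q x x)"
  have N: "N > 0" unfolding N_def by (rule pd[OF x(1)])
  have "cnj (sform A Q x x) = sform A Q x x" by (rule herm[symmetric])
  then have xx: "sform A Q x x = of_real N"
    unfolding N_def by (metis Reals_cnj_iff of_real_Re)
  \<comment> \<open>A sum over a single index makes the scaling an instance of
    \<open>sform_sum_left\<close> and \<open>sform_sum_right\<close>.\<close>
  define y where "y = (\<lambda>p. \<Sum>i\<in>{()}. of_real (1 / sqrt N) * x p)"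
  have right: "sform A Q s y = of_real (1 / sqrt N) * sform A Q s x" for s
    unfolding y_def sform_sum_right by simp
  have left: "sform A Q y s = of_real (1 / sqrt N) * sform A Q x s" for s
    unfolding y_def sform_sum_left by simp
  have "sform A Q y y = of_real (1 / sqrt N * (1 / sqrt N) * N)"
    unfolding left right xx of_real_mult by (simp only: mult.assoc)
  also have "1 / sqrt N * (1 / sqrt N) * N = 1" using N by simp
  finally have yy: "sform A Q y y = 1" by simp
  have gy: "sform A Q (g i) y = 0" if "i \<le> m" for i using gx[OF that] right by simp
  then have yg: "sform A Q y (g i) = 0" if "i \<le> m" for i using herm[of "g i" y] that by simp
  show ?case
    by (rule exI[of _ "g(Suc m := y)"]) (use g in \<open>auto simp: le_Suc_eq yy gy yg\<close>)
qed

text \<open>The matrix is an identity bordered by the row and column of \<open>w\<close>, and the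
  coefficient of |x w|^2 is the Schur complement of the identity block. Its sign is what both
  signature arguments below extract.\<close>

lemma complete_square:
  assumes I: "finite I" "w \<notin> I"
    and on: "\<And>i j. i \<in> I \<Longrightarrow> j \<in> I \<Longrightarrow> g i j = (if i = j then 1 else 0)"
    and herm: "\<And>i. i \<in> I \<Longrightarrow> g w i = cnj (g i w)"
  shows "Re (sform (insert w I) g x x) =
    (cmod (x w))\<^sup>2 * (Re (g w w) - (\<Sum>i\<in>I. (cmod (g i w))\<^sup>2)) + (\<Sum>i\<in>I. (cmod (x i + g i w * x w))\<^sup>2)"
proof -
  have inner: "(\<Sum>j\<in>I. cnj (x i) * g i j * x j) = cnj (x i) * x i" if "i \<in> I" for i
  proof -
    have "(\<Sum>j\<in>I. cnj (x i) * g i j * x j) = (\<Sum>j\<in>I. if i = j then cnj (x i) * x j else 0)"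
      by (rule sum.cong) (use on that in auto)
    then show ?thesis using I(1) that by simp
  qed
  have "sform (insert w I) g x x = cnj (x w) * g w w * x w +
     (\<Sum>i\<in>I. cnj (x w) * cnj (g i w) * x i + cnj (x i) * g i w * x w + cnj (x i) * x i)"
    unfolding sform_def using I by (simp add: sum.distrib inner herm)
  then have "Re (sform (insert w I) g x x) = Re (cnj (x w) * g w w * x w) +
     (\<Sum>i\<in>I. Re (cnj (x w) * cnj (g i w) * x i + cnj (x i) * g i w * x w + cnj (x i) * x i))"
    by simp
  also have "Re (cnj (x w) * g w w * x w) = (cmod (x w))\<^sup>2 * Re (g w w)"
    unfolding cmod_power2 by (simp add: power2_eq_square algebra_simps)
  also have "(\<Sum>i\<in>I. Re (cnj (x w) * cnj (g i w) * x i + cnj (x i) * g i w * x w + cnj (x i) * x i)) =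
      (\<Sum>i\<in>I. (cmod (x i + g i w * x w))\<^sup>2 - (cmod (x w))\<^sup>2 * (cmod (g i w))\<^sup>2)"
    by (rule sum.cong[OF refl]) (unfold cmod_power2, simp add: power2_eq_square algebra_simps)
  finally show ?thesis by (simp add: sum_subtractf sum_distrib_left algebra_simps)
qed

section \<open>The two signature bounds and their contradiction\<close>

text \<open>Summed over \<open>J\<close>, both right-hand sides consist of the same terms: each |h p
  w|^2 with \<open>w\<close> in \<open>J\<close> and \<open>p\<close> in \<open>I\<close> other than
  (0, 0) occurs once, since \<open>pt\<close> only permutes these entries up to conjugation. The
  terms for (0, 0) vanish, by \<open>corner\<close> in one case and by \<open>on\<close> in the
  other. So the sum of the diagonal entries is both at most and larger than one number.\<close>

lemma gram_contradiction:
  fixes h :: "nat \<times> nat \<Rightarrow> nat \<times> nat \<Rightarrow> complex"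
  defines "I \<equiv> {(0, 0), (0, 1), (0, 2), (1, 0), (2, 0)}" and "J \<equiv> {1, 2} \<times> {1, 2}"
  assumes herm: "\<And>p q. h q p = cnj (h p q)"
    and on: "\<And>p q. p \<in> I \<Longrightarrow> q \<in> I \<Longrightarrow> h p q = (if p = q then 1 else 0)"
    and corner: "\<And>w. w \<in> J \<Longrightarrow> h w (0, 0) = 0"
    and upper: "\<And>w. w \<in> J \<Longrightarrow> Re (h w w) \<le> (\<Sum>p\<in>I. (cmod (h p w))\<^sup>2)"
    and lower: "\<And>w. w \<in> J \<Longrightarrow> Re (h w w) > (\<Sum>p\<in>I. (cmod (pt h p w))\<^sup>2)"
  shows False
proof -
  define N where "N p q = (cmod (h p q))\<^sup>2" for p q
  have sym: "N q p = N p q" for p q unfolding N_def by (subst herm) simp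
  have 1: "Re (h w w) \<le> N (0, 1) w + N (0, 2) w + N (1, 0) w + N (2, 0) w" if "w \<in> J" for w
    using upper[OF that] corner[OF that] sym[of w "(0, 0)"] by (simp add: I_def N_def)
  have 2: "Re (h (j, l) (j, l)) >
      N (j, 1) (0, l) + N (j, 2) (0, l) + N (j, 0) (1, l) + N (j, 0) (2, l)" if "(j, l) \<in> J" for j l
  proof -
    have "h (j, 0) (0, l) = 0" using that by (subst on) (auto simp: I_def J_def)
    then show ?thesis using lower[OF that] by (simp add: I_def N_def pt_def)
  qed
  have J: "(1, 1) \<in> J" "(1, 2) \<in> J" "(2, 1) \<in> J" "(2, 2) \<in> J" by (auto simp: J_def)
  show False
    using J[THEN 1] J[THEN 2] sym[of "(1, 1)"] sym[of "(1, 2)"] sym[of "(2, 1)"] sym[of "(2, 2)"]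
    by simp
qed

lemma partial_transpose_4_positive_4_negative:
  fixes G :: "nat \<times> nat \<Rightarrow> nat \<times> nat \<Rightarrow> complex" and d :: "nat \<Rightarrow> real"
  defines "P \<equiv> {..<3} \<times> {..<3}"
  assumes herm: "\<And>p q. p \<in> P \<Longrightarrow> q \<in> P \<Longrightarrow> G q p = cnj (G p q)"
    and psd: "\<And>v. Re (sform P G v v) \<ge> 0"
    and diag: "\<And>p q. p \<in> P \<Longrightarrow> q \<in> P \<Longrightarrow> pt G p q = (\<Sum>i<9. of_real (d i) * u i p * cnj (u i q))"
    and complete: "\<And>p q. p \<in> P \<Longrightarrow> q \<in> P \<Longrightarrow> (\<Sum>i<9. u i p * cnj (u i q)) = (if p = q then 1 else 0)"
    and neg: "card {i. i < 9 \<and> d i < 0} = 4" and pos: "card {i. i < 9 \<and> d i > 0} = 4"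
  shows False
proof -
  have finP: "finite P" by (simp add: P_def)
  have spectral: "sform P (pt G) s t = (\<Sum>i<9. of_real (d i) * (cnj (ip P (u i) s) * ip P (u i) t))" for s t
  proof -
    have "sform P (pt G) s t = sform P (\<lambda>p q. \<Sum>i<9. of_real (d i) * u i p * cnj (u i q)) s t"
      unfolding sform_def by (intro sum.cong refl) (simp add: diag)
    then show ?thesis by (simp add: sform_spectral)
  qed
  have parseval: "ip P s t = (\<Sum>i<9. cnj (ip P (u i) s) * ip P (u i) t)" for s t
  proof -
    have "ip P s t = sform P (\<lambda>p q. if p = q then 1 else 0) s t"
      using finP by (simp add: sform_def ip_def if_distrib if_distribR cong: if_cong)
    also have "\<dots> = sform P (\<lambda>p q. \<Sum>i<9. 1 * u i p * cnj (u i q)) s t"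
      unfolding sform_def by (intro sum.cong refl) (simp add: complete)
    also have "\<dots> = (\<Sum>i<9. cnj (ip P (u i) s) * ip P (u i) t)"
      by (subst sform_spectral) simp
    finally show ?thesis .
  qed
  have quad: "cnj z * z = of_real ((cmod z)\<^sup>2)" for z
    by (metis complex_norm_square mult.commute)
  have spectral_quad: "Re (sform P (pt G) s s) = (\<Sum>i<9. d i * (cmod (ip P (u i) s))\<^sup>2)" for s
    unfolding spectral quad by (simp only: Re_complex_of_real flip: of_real_mult of_real_sum)
  have parseval_quad: "Re (ip P s s) = (\<Sum>i<9. (cmod (ip P (u i) s))\<^sup>2)" for s
    unfolding parseval[of s s] quad by (simp only: Re_complex_of_real flip: of_real_sum)

  \<comment> \<open>Orthogonality of a (x) b to the four eigenvectors is a bilinear system of n + 1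
    equations with n = 3.\<close>
  obtain a b where a: "\<exists>j\<in>{..<3}. a j \<noteq> 0" and b: "\<exists>k\<in>{..<3}. b k \<noteq> 0"
    and ab: "\<forall>i\<in>{i. i < 9 \<and> d i > 0}. (\<Sum>j<3. \<Sum>k<3. cnj (u i (j, k)) * a j * b k) = 0"
    using bilinear_system_nontrivial[of 3 "{i. i < 9 \<and> d i > 0}" "\<lambda>i j k. cnj (u i (j, k))"] pos by auto
  \<comment> \<open>The largest shift under which none of the negative eigenvalues becomes
    positive.\<close>
  define \<epsilon> where "\<epsilon> = Min ((\<lambda>i. - d i) ` {i. i < 9 \<and> d i < 0})"
  have ne: "{i. i < 9 \<and> d i < 0} \<noteq> {}" using neg by (metis card.empty zero_neq_numeral)
  have \<epsilon>: "\<epsilon> > 0" unfolding \<epsilon>_def by (subst Min_gr_iff) (use ne in auto)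
  have d\<epsilon>: "d i + \<epsilon> \<le> 0" if "i < 9" "d i < 0" for i
  proof -
    have "\<epsilon> \<le> - d i" unfolding \<epsilon>_def by (rule Min_le) (use that in auto)
    then show ?thesis by simp
  qed
  define Na Nb where "Na = Re (ip {..<3} a a)" and "Nb = Re (ip {..<3} b b)"
  have Nab: "Na > 0" "Nb > 0" unfolding Na_def Nb_def using a b by (auto intro!: ip_self_pos)
  \<comment> \<open>Chosen so that f0 (x) b gets norm 1 for the shifted partial transpose. The
    unshifted part will vanish there, which leaves \<open>\<epsilon>\<close> times the ordinary
    squared norm.\<close>
  define c where "c = 1 / sqrt (\<epsilon> * Na * Nb)"
  have c: "c > 0" "\<epsilon> * (c * c * Na) * Nb = 1" using Nab \<epsilon> by (auto simp: c_def field_simps)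
  define f0 where "f0 = (\<lambda>j. of_real c * a j)"
  have "ip {..<3} f0 f0 = of_real (c * c * Na)"
    unfolding f0_def ip_scale_left ip_scale_right Na_def by (simp add: ip_self)
  moreover have "ip {..<3} b b = of_real Nb" by (simp add: Nb_def ip_self)
  ultimately have norm: "of_real \<epsilon> * (ip {..<3} f0 f0 * ip {..<3} b b) = 1"
    using c(2) by (metis mult.assoc of_real_1 of_real_mult)
  have L: "ip P (u i) (tens f0 b) = 0" if "i < 9" "d i > 0" for i
  proof -
    have "ip P (u i) (tens f0 b) = (\<Sum>j<3. \<Sum>k<3. of_real c * (cnj (u i (j, k)) * a j * b k))"
      unfolding ip_def P_def sum.cartesian_product' by (simp add: tens_def f0_def mult_ac)
    also have "\<dots> = 0" using ab that by (simp flip: sum_distrib_left)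
    finally show ?thesis .
  qed

  \<comment> \<open>The form is nonnegative at a product vector, while every term of its spectral
    sum is at most 0. Hence all terms vanish, and f0 (x) b lies in the kernel of
    \<open>pt G\<close>.\<close>
  have nullH: "Re (sform P (pt G) (tens f0 b) (tens f0 b)) \<ge> 0"
    unfolding P_def sform_pt_tens by (fold P_def) (rule psd)
  have terms: "d i * (cmod (ip P (u i) (tens f0 b)))\<^sup>2 \<le> 0" if "i < 9" for i
    using L[OF that] by (cases "d i > 0") (auto simp: mult_nonpos_nonneg)
  have "(\<Sum>i<9. - (d i * (cmod (ip P (u i) (tens f0 b)))\<^sup>2)) = 0"
    using nullH sum_nonpos[of "{..<9}" "\<lambda>i. d i * (cmod (ip P (u i) (tens f0 b)))\<^sup>2"] terms
    unfolding spectral_quad by (simp add: sum_negf)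
  then have zero: "d i * (cmod (ip P (u i) (tens f0 b)))\<^sup>2 = 0" if "i < 9" for i
    using sum_nonneg_eq_0_iff[of "{..<9}" "\<lambda>i. - (d i * (cmod (ip P (u i) (tens f0 b)))\<^sup>2)"] terms that
    by auto
  have kerH: "sform P (pt G) s (tens f0 b) = 0" for s
    unfolding spectral by (rule sum.neutral) (use zero in auto)
  have kerM: "sform P G s (tens (conj_fun f0) b) = 0" for s
  proof (rule psd_form_null_vector[OF herm psd])
    show "Re (sform P G (tens (conj_fun f0) b) (tens (conj_fun f0) b)) = 0"
      using kerH[of "tens f0 b"] unfolding P_def sform_pt_tens by simp
  qed

  \<comment> \<open>From here on \<open>H\<close> is the shifted partial transpose. On nonzero
    product vectors it is strictly positive, because its values there are values of the positive
    definite \<open>shift \<epsilon> G\<close>.\<close>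
  define H where "H = pt (shift \<epsilon> G)"
  have H: "H = shift \<epsilon> (pt G)" by (simp add: H_def pt_shift)
  have hermM': "shift \<epsilon> G q p = cnj (shift \<epsilon> G p q)" if "p \<in> P" "q \<in> P" for p q
    using herm[OF that] by (auto simp: shift_def)
  have hermH: "sform P H y x = cnj (sform P H x y)" for x y
  proof (rule sform_herm)
    fix p q assume "p \<in> P" "q \<in> P"
    then have "(fst p, snd q) \<in> P" "(fst q, snd p) \<in> P" by (auto simp: P_def)
    then show "H q p = cnj (H p q)" unfolding H_def pt_def by (rule hermM'[rotated])
  qed
  have M'pos: "Re (sform P (shift \<epsilon> G) v v) > 0" if "\<exists>p\<in>P. v p \<noteq> 0" for v
    using psd[of v] ip_self_pos[OF finP that] \<epsilon>
    by (simp add: sform_shift[OF finP] add_nonneg_pos)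
  have Hprod: "sform P H (tens x y) (tens z w) =
      sform P (shift \<epsilon> G) (tens (conj_fun z) y) (tens (conj_fun x) w)" for x y z w
    unfolding H_def P_def by (rule sform_pt_tens)
  have Hf0b: "sform P H (tens x y) (tens f0 b) = of_real \<epsilon> * (ip {..<3} x f0 * ip {..<3} y b)" for x y
    by (simp add: H sform_shift[OF finP] kerH) (simp add: P_def ip_tens)
  have Hpos: "Re (sform P H (tens x y) (tens x y)) > 0" if "\<exists>j\<in>{..<3}. x j \<noteq> 0" "\<exists>k\<in>{..<3}. y k \<noteq> 0" for x y
    unfolding Hprod by (rule M'pos) (use that in \<open>auto simp: P_def tens_def conj_fun_def\<close>)
  have f0: "\<exists>j\<in>{..<3}. f0 j \<noteq> 0" using a c(1) by (auto simp: f0_def)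

  have slice_snd: "sform P H (tens x y) (tens x y') =
      sform {..<3} (\<lambda>k l. sform {..<3} (\<lambda>i j. H (i, k) (j, l)) x x) y y'" for x y y'
    unfolding P_def by (rule sform_tens_slice_snd)
  have slice_fst: "sform P H (tens x y) (tens x' y) =
      sform {..<3} (\<lambda>i j. sform {..<3} (\<lambda>k l. H (i, k) (j, l)) y y) x x'" for x x' y
    unfolding P_def by (rule sform_tens_slice_fst)
  \<comment> \<open>With f0 fixed in the first factor, \<open>H\<close> gives a positive definite
    form on the second factor. Rewriting by \<open>slice_snd\<close> shows it as an
    \<open>sform\<close>, so that \<open>b\<close> extends to an orthonormal family; below the roles
    of the factors are exchanged.\<close>
  have "\<exists>g. g 0 = b \<and> (\<forall>i\<le>(2 :: nat). \<forall>j\<le>2. sform P H (tens f0 (g i)) (tens f0 (g j)) =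
      (if i = j then 1 else 0))"
  proof (unfold slice_snd, rule orthonormal_extension, unfold slice_snd[symmetric])
    show "sform P H (tens f0 y) (tens f0 x) = cnj (sform P H (tens f0 x) (tens f0 y))" for x y
      by (rule hermH)
    show "Re (sform P H (tens f0 x) (tens f0 x)) > 0" if "\<exists>p\<in>{..<3}. x p \<noteq> 0" for x
      by (rule Hpos[OF f0 that])
    show "sform P H (tens f0 b) (tens f0 b) = 1" by (simp only: Hf0b norm)
  qed simp_all
  then obtain g where g: "g 0 = b"
    and gon': "\<forall>i\<le>(2 :: nat). \<forall>j\<le>2. sform P H (tens f0 (g i)) (tens f0 (g j)) = (if i = j then 1 else 0)"
    by blast
  have gon: "sform P H (tens f0 (g i)) (tens f0 (g j)) = (if i = j then 1 else 0)" if "i \<le> 2" "j \<le> 2" for i j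
    using gon' that by blast
  have "\<exists>f. f 0 = f0 \<and> (\<forall>i\<le>(2 :: nat). \<forall>j\<le>2. sform P H (tens (f i) b) (tens (f j) b) =
      (if i = j then 1 else 0))"
  proof (unfold slice_fst, rule orthonormal_extension, unfold slice_fst[symmetric])
    show "sform P H (tens y b) (tens x b) = cnj (sform P H (tens x b) (tens y b))" for x y
      by (rule hermH)
    show "Re (sform P H (tens x b) (tens x b)) > 0" if "\<exists>p\<in>{..<3}. x p \<noteq> 0" for x
      by (rule Hpos[OF that b])
    show "sform P H (tens f0 b) (tens f0 b) = 1" by (simp only: Hf0b norm)
  qed simp_all
  then obtain f where f: "f 0 = f0"
    and fon': "\<forall>i\<le>(2 :: nat). \<forall>j\<le>2. sform P H (tens (f i) b) (tens (f j) b) = (if i = j then 1 else 0)"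
    by blast
  have fon: "sform P H (tens (f i) b) (tens (f j) b) = (if i = j then 1 else 0)" if "i \<le> 2" "j \<le> 2" for i j
    using fon' that by blast

  have f0f0: "ip {..<3} f0 f0 \<noteq> 0" and bb: "ip {..<3} b b \<noteq> 0" using norm by auto
  \<comment> \<open>By \<open>Hf0b\<close>, pairing with f0 (x) b under \<open>H\<close> is a
    multiple of the ordinary inner product, so orthogonality for \<open>H\<close> becomes ordinary
    orthogonality to \<open>b\<close> and to \<open>f0\<close>.\<close>
  have gb: "ip {..<3} (g l) b = 0" if "l \<in> {1, 2}" for l
    using gon[of l 0] that \<epsilon> f0f0 by (auto simp: g Hf0b)
  have ff0: "ip {..<3} (f j) f0 = 0" if "j \<in> {1, 2}" for j
    using fon[of j 0] that \<epsilon> bb by (auto simp: f Hf0b)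
  have f0f: "ip {..<3} f0 (f j) = 0" if "j \<in> {1, 2}" for j
    using ip_cnj[of "{..<3}" "f j" f0] ff0[OF that] by simp
  \<comment> \<open>\<open>e'\<close> conjugates the first factors of \<open>e\<close>, so that by
    \<open>pth\<close> the Gram matrix of \<open>e'\<close> for the shifted \<open>G\<close> is the
    partial transpose of the Gram matrix \<open>h\<close> of \<open>e\<close> for
    \<open>H\<close>.\<close>
  define e where "e p = tens (f (fst p)) (g (snd p))" for p :: "nat \<times> nat"
  define e' where "e' p = tens (conj_fun (f (fst p))) (g (snd p))" for p :: "nat \<times> nat"
  define h where "h p q = sform P H (e p) (e q)" for p q
  have pth: "sform P (shift \<epsilon> G) (e' p) (e' q) = pt h p q" for p q
    by (simp add: pt_def h_def e_def e'_def Hprod)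
  define I :: "(nat \<times> nat) set" where "I = {(0, 0), (0, 1), (0, 2), (1, 0), (2, 0)}"
  define J :: "(nat \<times> nat) set" where "J = {1, 2} \<times> {1, 2}"
  have hh: "h q p = cnj (h p q)" for p q unfolding h_def by (rule hermH)
  have corner: "h w (0, 0) = 0" if "w \<in> J" for w
    using that gb by (auto simp: h_def e_def f g Hf0b J_def)
  have corner1: "h (j, l) (0, 0) = 0" if "j \<in> {1, 2}" "l \<in> {1, 2}" for j l
    using corner[of "(j, l)"] that by (auto simp: J_def)
  have corner2: "h (0, 0) (j, l) = 0" if "j \<in> {1, 2}" "l \<in> {1, 2}" for j l
    using corner1[OF that] hh[of "(0, 0)" "(j, l)"] by simp
  \<comment> \<open>Neither orthonormal family controls these entries. Carried over to the shifted
    \<open>G\<close>, the second argument becomes the kernel vector of \<open>G\<close>, and only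
    the \<open>\<epsilon>\<close>-term is left.\<close>
  have cross: "h (0, l) (j, 0) = 0" if "l \<in> {1, 2}" "j \<in> {1, 2}" for j l
  proof -
    have "h (0, l) (j, 0) = sform P (shift \<epsilon> G) (tens (conj_fun (f j)) (g l)) (tens (conj_fun f0) b)"
      by (simp add: h_def e_def f g Hprod)
    also have "\<dots> = of_real \<epsilon> * (ip {..<3} (conj_fun (f j)) (conj_fun f0) * ip {..<3} (g l) b)"
      by (simp add: sform_shift[OF finP] kerM) (simp add: P_def ip_tens)
    finally show ?thesis using gb[OF that(1)] by simp
  qed
  have row0: "h (0, k) (0, l) = (if k = l then 1 else 0)" if "k \<le> 2" "l \<le> 2" for k l
    using gon[OF that] by (simp add: h_def e_def f)
  have col0: "h (i, 0) (j, 0) = (if i = j then 1 else 0)" if "i \<le> 2" "j \<le> 2" for i j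
    using fon[OF that] by (simp add: h_def e_def g)
  have cross': "h (j, 0) (0, l) = 0" if "l \<in> {1, 2}" "j \<in> {1, 2}" for j l
    using hh[of "(j, 0)" "(0, l)"] cross[OF that] by simp
  have on: "h p q = (if p = q then 1 else 0)" if "p \<in> I" "q \<in> I" for p q
    using that unfolding I_def by (auto simp: row0 col0 cross cross')
  have IJ: "finite I" "card I = 5" "w \<notin> I" if "w \<in> J" for w
    using that by (auto simp: I_def J_def)

  \<comment> \<open>Six vectors face five indices with \<open>d i\<close> nonnegative, so a
    nontrivial combination \<open>v\<close> is orthogonal to those eigenvectors, and
    \<open>H\<close> is at most 0 at \<open>v\<close>. As \<open>H\<close> is positive definite on
    combinations over \<open>I\<close>, \<open>x w\<close> is nonzero, and completing the square
    makes the Schur complement at most 0.\<close>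
  have upper: "Re (h w w) \<le> (\<Sum>p\<in>I. (cmod (h p w))\<^sup>2)" if w: "w \<in> J" for w
  proof -
    define N where "N = {i. i < 9 \<and> \<not> d i < 0}"
    have "card (N \<union> {i. i < 9 \<and> d i < 0}) = card N + card {i. i < 9 \<and> d i < 0}"
      by (rule card_Un_disjoint) (auto simp: N_def)
    moreover have "N \<union> {i. i < 9 \<and> d i < 0} = {..<9}" by (auto simp: N_def)
    ultimately have "card N < card (insert w I)" using neg IJ[OF w] by simp
    moreover have "finite N" "finite (insert w I)" using IJ[OF w] by (simp_all add: N_def)
    ultimately obtain x where x: "\<exists>p\<in>insert w I. x p \<noteq> 0"
      and x': "\<forall>i\<in>N. (\<Sum>p\<in>insert w I. ip P (u i) (e p) * x p) = 0"
      using homogeneous_system_nontrivial[of N "insert w I" "\<lambda>i p. ip P (u i) (e p)"] by blast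
    define v where "v = (\<lambda>q. \<Sum>p\<in>insert w I. x p * e p q)"
    have Lv: "ip P (u i) v = 0" if "i \<in> N" for i
      unfolding v_def ip_sum_right using bspec[OF x' that] by (simp only: mult.commute)
    have "Re (sform P H v v) = (\<Sum>i<9. (d i + \<epsilon>) * (cmod (ip P (u i) v))\<^sup>2)"
      unfolding H sform_shift[OF finP]
      by (simp add: spectral_quad parseval_quad distrib_right sum.distrib sum_distrib_left)
    also have "\<dots> \<le> 0"
    proof (rule sum_nonpos)
      fix i :: nat assume "i \<in> {..<9}"
      then show "(d i + \<epsilon>) * (cmod (ip P (u i) v))\<^sup>2 \<le> 0"
        using Lv[of i] d\<epsilon>[of i] by (cases "d i < 0") (auto simp: N_def mult_nonpos_nonneg)
    qed
    finally have "Re (sform (insert w I) h x x) \<le> 0"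
      unfolding v_def sform_gram h_def .
    then have le: "(cmod (x w))\<^sup>2 * (Re (h w w) - (\<Sum>i\<in>I. (cmod (h i w))\<^sup>2)) +
        (\<Sum>i\<in>I. (cmod (x i + h i w * x w))\<^sup>2) \<le> 0"
      by (simp only: complete_square[OF IJ(1)[OF w] IJ(3)[OF w] on hh])
    have nonneg: "(\<Sum>i\<in>I. (cmod (x i + h i w * x w))\<^sup>2) \<ge> 0" by (rule sum_nonneg) simp
    have "x w \<noteq> 0"
    proof
      assume xw: "x w = 0"
      then have "\<exists>p\<in>I. x p \<noteq> 0" using x by auto
      with sum_cmod_square_pos[OF IJ(1)[OF w] this] le xw show False by simp
    qed
    then have "(cmod (x w))\<^sup>2 > 0" by simp
    moreover have "(cmod (x w))\<^sup>2 * (Re (h w w) - (\<Sum>i\<in>I. (cmod (h i w))\<^sup>2)) \<le> 0"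
      using le nonneg by linarith
    ultimately show ?thesis by (simp add: mult_le_0_iff)
  qed

  have lower: "Re (h w w) > (\<Sum>p\<in>I. (cmod (pt h p w))\<^sup>2)" if w: "w \<in> J" for w
  proof -
    \<comment> \<open>These coefficients annihilate all completed squares, so the form at
      \<open>v\<close> equals the Schur complement, which is positive once \<open>v\<close> is
      nonzero.\<close>
    define x where "x p = (if p = w then 1 else - pt h p w)" for p
    define v where "v = (\<lambda>q. \<Sum>p\<in>insert w I. x p * e' p q)"
    \<comment> \<open>\<open>pt\<close> replaces the entries between (0, l) and (j, 0) by those
      between (j, l) and (0, 0), which vanish by \<open>corner1\<close> and
      \<open>corner2\<close>.\<close>
    have onpt: "pt h p q = (if p = q then 1 else 0)" if "p \<in> I" "q \<in> I" for p q
      using that unfolding I_def by (auto simp: pt_def row0 col0 corner1 corner2)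
    have hpt: "pt h w p = cnj (pt h p w)" for p unfolding pt_def by (subst hh) simp
    \<comment> \<open>Each \<open>p\<close> in \<open>I\<close> involves \<open>f0\<close> or
      \<open>b\<close>, to which the corresponding factor of \<open>w\<close> is orthogonal in the
      ordinary sense. So the inner product of \<open>v\<close> with \<open>e' w\<close> is the
      squared norm of \<open>e' w\<close>, and \<open>v\<close> is nonzero.\<close>
    have "ip P (e' w) (e' p) = 0" if "p \<in> I" for p
      using that w by (auto simp: I_def J_def e'_def P_def ip_tens ip_conj_fun f g gb f0f)
    then have "ip P (e' w) v = ip P (e' w) (e' w)"
      unfolding v_def ip_sum_right using IJ[OF w] by (simp add: x_def)
    also have "\<dots> \<noteq> 0"
    proof -
      have nz: "ip {..<3} y y \<noteq> 0" if "\<exists>k\<in>{..<3}. y k \<noteq> 0" for y :: "nat \<Rightarrow> complex"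
        using ip_self_pos[OF finite_lessThan that] by auto
      have "\<exists>k\<in>{..<3}. g (snd w) k \<noteq> 0"
      proof (rule ccontr)
        assume "\<not> ?thesis"
        then have "h (0, snd w) (0, snd w) = 0"
          by (auto simp: h_def e_def sform_def P_def tens_def intro!: sum.neutral)
        then show False using row0[of "snd w" "snd w"] w by (auto simp: J_def)
      qed
      moreover have "\<exists>k\<in>{..<3}. f (fst w) k \<noteq> 0"
      proof (rule ccontr)
        assume "\<not> ?thesis"
        then have "h (fst w, 0) (fst w, 0) = 0"
          by (auto simp: h_def e_def sform_def P_def tens_def intro!: sum.neutral)
        then show False using col0[of "fst w" "fst w"] w by (auto simp: J_def)
      qed
      ultimately show ?thesis using nz by (simp add: e'_def P_def ip_tens ip_conj_fun)
    qed
    finally have "ip P (e' w) v \<noteq> 0" .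
    have "\<exists>p\<in>P. v p \<noteq> 0"
    proof (rule ccontr)
      assume "\<not> ?thesis"
      then have "ip P (e' w) v = 0" unfolding ip_def by (intro sum.neutral) simp
      with \<open>ip P (e' w) v \<noteq> 0\<close> show False by contradiction
    qed
    then have "0 < Re (sform P (shift \<epsilon> G) v v)" by (rule M'pos)
    also have "sform P (shift \<epsilon> G) v v = sform (insert w I) (pt h) x x"
      unfolding v_def sform_gram pth ..
    also have "Re \<dots> = (cmod (x w))\<^sup>2 * (Re (pt h w w) - (\<Sum>i\<in>I. (cmod (pt h i w))\<^sup>2)) +
        (\<Sum>i\<in>I. (cmod (x i + pt h i w * x w))\<^sup>2)"
      by (rule complete_square[OF IJ(1)[OF w] IJ(3)[OF w] onpt hpt])
    also have "(\<Sum>i\<in>I. (cmod (x i + pt h i w * x w))\<^sup>2) = 0"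
      by (rule sum.neutral) (use IJ(3)[OF w] in \<open>auto simp: x_def\<close>)
    finally show ?thesis by (simp add: x_def pt_def)
  qed
  show False
    by (rule gram_contradiction[of h, folded I_def J_def, OF hh on corner upper lower])
qed

section \<open>From index pairs back to matrices\<close>

lemma sum_lessThan_mult:
  fixes m n :: nat
  shows "(\<Sum>r<m * n. f r) = (\<Sum>p\<in>{..<m} \<times> {..<n}. f (fst p * n + snd p))"
proof (rule sum.reindex_bij_witness[where i = "\<lambda>p. fst p * n + snd p" and j = "\<lambda>r. (r div n, r mod n)"])
  fix r assume "r \<in> {..<m * n}"
  then show "(r div n, r mod n) \<in> {..<m} \<times> {..<n}"
    by (auto simp: less_mult_imp_div_less intro!: mod_less_divisor) (metis mult_0_right neq0_conv not_less0)
qed (auto simp: block_index_less)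

lemma index_mat_adjoint:
  "i < dim_col A \<Longrightarrow> j < dim_row A \<Longrightarrow> mat_adjoint A $$ (i, j) = conjugate (A $$ (j, i))"
  by (simp add: mat_adjoint_def mat_of_rows_index)

lemma dim_mat_adjoint: "dim_row (mat_adjoint A) = dim_col A" "dim_col (mat_adjoint A) = dim_row A"
  by (simp_all add: mat_adjoint_def)

lemma hermitian_partial_transpose:
  assumes M: "M \<in> carrier_mat (m * n) (m * n)" and herm: "hermitian_mat M"
  shows "hermitian_mat (partial_transpose m n M)"
proof -
  have "mat_adjoint (partial_transpose m n M) = partial_transpose m n M"
  proof (rule eq_matI)
    fix r c assume "r < dim_row (partial_transpose m n M)" "c < dim_col (partial_transpose m n M)"
    then have rc: "r < m * n" "c < m * n" by (simp_all add: partial_transpose_def)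
    then have n: "n > 0" by (metis mult_0_right neq0_conv not_less0)
    have "r div n < m" "c div n < m" "r mod n < n" "c mod n < n"
      using rc n by (simp_all add: less_mult_imp_div_less)
    then have "M $$ (r div n * n + c mod n, c div n * n + r mod n) =
        cnj (M $$ (c div n * n + r mod n, r div n * n + c mod n))"
      by (intro hermitian_mat_entry[OF herm M] block_index_less)
    then show "mat_adjoint (partial_transpose m n M) $$ (r, c) = partial_transpose m n M $$ (r, c)"
      using rc by (simp add: index_mat_adjoint partial_transpose_def)
  qed (simp_all add: dim_mat_adjoint partial_transpose_def)
  then show ?thesis by (simp add: hermitian_mat_def partial_transpose_def)
qed

lemma no_state_inertia_4_1_4:
  assumes M: "M \<in> states 3 3"
  shows "inertia (partial_transpose 3 3 M) \<noteq> (4, 1, 4)"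
proof
  assume inertia: "inertia (partial_transpose 3 3 M) = (4, 1, 4)"
  have car: "M \<in> carrier_mat (3 * 3) (3 * 3)" and herm: "hermitian_mat M"
    and psd: "\<And>v. v \<in> carrier_vec 9 \<Longrightarrow> 0 \<le> (M *\<^sub>v v) \<bullet>c v"
    using M by (auto simp: states_def psd_mat_def)
  define P :: "(nat \<times> nat) set" where "P = {..<3} \<times> {..<3}"
  \<comment> \<open>The numbering of pairs that \<open>partial_transpose\<close> uses for rows and
    columns.\<close>
  define \<iota> where "\<iota> p = fst p * 3 + snd p" for p :: "nat \<times> nat"
  have \<iota>: "\<iota> p < 3 * 3" if "p \<in> P" for p
    unfolding \<iota>_def by (rule block_index_less) (use that in \<open>auto simp: P_def\<close>)
  have \<iota>_div_mod: "\<iota> p div 3 = fst p" "\<iota> p mod 3 = snd p" if "p \<in> P" for p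
    using that by (auto simp: \<iota>_def P_def)
  then have \<iota>_inj: "\<iota> p = \<iota> q \<longleftrightarrow> p = q" if "p \<in> P" "q \<in> P" for p q
    using that by (metis prod_eq_iff)
  have sum_\<iota>: "(\<Sum>r<9. f r) = (\<Sum>p\<in>P. f (\<iota> p))" for f :: "nat \<Rightarrow> complex"
    using sum_lessThan_mult[of f 3 3] by (simp add: P_def \<iota>_def)
  define G where "G p q = M $$ (\<iota> p, \<iota> q)" for p q
  have "partial_transpose 3 3 M \<in> carrier_mat (3 * 3) (3 * 3)" by (simp add: partial_transpose_def)
  then obtain u and d :: "nat \<Rightarrow> real" where
    diag: "\<forall>r<3 * 3. \<forall>s<3 * 3. partial_transpose 3 3 M $$ (r, s) =
      (\<Sum>i<3 * 3. of_real (d i) * u i r * cnj (u i s))"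
    and complete: "\<forall>r<3 * 3. \<forall>s<3 * 3. (\<Sum>i<3 * 3. u i r * cnj (u i s)) = (if r = s then 1 else 0)"
    and counts: "inertia (partial_transpose 3 3 M) = (card {i. i < 3 * 3 \<and> d i < 0},
      card {i. i < 3 * 3 \<and> d i = 0}, card {i. i < 3 * 3 \<and> d i > 0})"
    using hermitian_diagonalization_inertia[OF _ hermitian_partial_transpose[OF car herm]] by blast
  show False
  proof (rule partial_transpose_4_positive_4_negative[of G d "\<lambda>i p. u i (\<iota> p)", folded P_def])
    fix p q assume pq: "p \<in> P" "q \<in> P"
    show "G q p = cnj (G p q)" unfolding G_def
      by (rule hermitian_mat_entry[OF herm car]) (use pq \<iota> in auto)
    have "pt G p q = partial_transpose 3 3 M $$ (\<iota> p, \<iota> q)"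
      using pq unfolding pt_def G_def \<iota>_def P_def by (subst index_partial_transpose) auto
    also have "\<dots> = (\<Sum>i<3 * 3. of_real (d i) * u i (\<iota> p) * cnj (u i (\<iota> q)))"
      using diag \<iota>[OF pq(1)] \<iota>[OF pq(2)] by blast
    finally show "pt G p q = (\<Sum>i<9. of_real (d i) * u i (\<iota> p) * cnj (u i (\<iota> q)))" by simp
    have "(\<Sum>i<3 * 3. u i (\<iota> p) * cnj (u i (\<iota> q))) = (if \<iota> p = \<iota> q then 1 else 0)"
      using complete \<iota>[OF pq(1)] \<iota>[OF pq(2)] by blast
    then show "(\<Sum>i<9. u i (\<iota> p) * cnj (u i (\<iota> q))) = (if p = q then 1 else 0)"
      using \<iota>_inj[OF pq] by simp
  next
    fix v :: "nat \<times> nat \<Rightarrow> complex"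
    define x where "x = vec 9 (\<lambda>r. v (r div 3, r mod 3))"
    have x: "x $ \<iota> p = v p" if "p \<in> P" for p
      using \<iota>[OF that] \<iota>_div_mod[OF that] by (simp add: x_def)
    have "(M *\<^sub>v x) \<bullet>c x = (\<Sum>r<9. (\<Sum>s<9. M $$ (r, s) * x $ s) * cnj (x $ r))"
      using car by (simp add: scalar_prod_def x_def atLeast0LessThan)
    also have "\<dots> = (\<Sum>p\<in>P. (\<Sum>q\<in>P. M $$ (\<iota> p, \<iota> q) * x $ \<iota> q) * cnj (x $ \<iota> p))"
      unfolding sum_\<iota> ..
    also have "\<dots> = sform P G v v"
      unfolding sform_def sum_distrib_right by (intro sum.cong refl) (simp add: x G_def)
    finally have "(M *\<^sub>v x) \<bullet>c x = sform P G v v" .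
    moreover have "0 \<le> (M *\<^sub>v x) \<bullet>c x" by (rule psd) (simp add: x_def)
    ultimately show "Re (sform P G v v) \<ge> 0" by (simp add: less_eq_complex_def)
  next
    show "card {i. i < 9 \<and> d i < 0} = 4" "card {i. i < 9 \<and> d i > 0} = 4"
      using counts inertia by simp_all
  qed
qed

theorem theorem13:
  shows
    "(\<forall>M \<in> states 3 3. inertia (partial_transpose 3 3 M) = (4, 1, 4) \<longrightarrow>
        (\<forall>Q \<in> carrier_mat 9 9. vec_space.rank 9 Q \<ge> 6 \<longrightarrow>
           \<not> psd_mat (Q * partial_transpose 3 3 M * mat_adjoint Q)) \<and>
        (\<forall>P \<in> carrier_mat 2 3. vec_space.rank 2 P = 2 \<longrightarrow>
           kron P (1\<^sub>m 3) * M * kron (mat_adjoint P) (1\<^sub>m 3) \<in> npt_states 2 3)) \<and>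
     (\<not> (\<exists>M \<in> states 3 3. inertia (partial_transpose 3 3 M) = (4, 1, 4))) \<and>
     (4, 1, 4) \<notin> npt_inertias 3 3"
proof (intro conjI ballI impI)
  \<comment> \<open>The first two claims concern a matrix that cannot exist, so each follows from
    the contradiction with \<open>no_state_inertia_4_1_4\<close>.\<close>
  fix M Q :: "complex mat"
  assume "M \<in> states 3 3" "inertia (partial_transpose 3 3 M) = (4, 1, 4)"
  then show "\<not> psd_mat (Q * partial_transpose 3 3 M * mat_adjoint Q)"
    by (rule notE[OF no_state_inertia_4_1_4])
next
  fix M P :: "complex mat"
  assume "M \<in> states 3 3" "inertia (partial_transpose 3 3 M) = (4, 1, 4)"
  then show "kron P (1\<^sub>m 3) * M * kron (mat_adjoint P) (1\<^sub>m 3) \<in> npt_states 2 3"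
    by (rule notE[OF no_state_inertia_4_1_4])
next
  show "\<not> (\<exists>M \<in> states 3 3. inertia (partial_transpose 3 3 M) = (4, 1, 4))"
    using no_state_inertia_4_1_4 by blast
next
  show "(4, 1, 4) \<notin> npt_inertias 3 3"
  proof
    assume "(4, 1, 4) \<in> npt_inertias 3 3"
    then obtain M where M: "M \<in> npt_states 3 3" "(4, 1, 4) = inertia (partial_transpose 3 3 M)"
      unfolding npt_inertias_def by (rule imageE)
    have "M \<in> states 3 3" using M(1) by (simp add: npt_states_def)
    from no_state_inertia_4_1_4[OF this] M(2) show False by (rule notE[OF _ sym])
  qed
qed

end
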